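(* Let $X$ be a (complex) Banach space such that the set $D=\{x^*\in\partial_e B(X^* ):\ \mathrm{span}\{x^*\}\text{ is an }L\text{-summand of }X^*\}$ is $w^*$-dense in $\partial_e B(X^* )$, and suppose that $\overline{\partial_e B(X^* )}^{w^*}\subset S(X^* )$. If $X$ has property $(\dagger)$, then $X$ is isometric to $\ell^\infty(k)$ for some integer $k>0$. In particular, any uniform algebra satisfying property $(\ddagger)$ is finite-dimensional.
   Context: All Banach spaces are complex. For a Banach space $X$, $B(X)$ and $S(X)$ denote its closed unit ball and unit sphere, $X^*$ its dual, and $\partial_e B(X^* )$ the set of extreme points of $B(X^* )$. A closed subspace $M\subset X^*$ is an $L$-summand if $X^*=M\bigoplus_1 N$ for some closed subspace $N$, i.e. $X^*=M\oplus N$ algebraically and $\|m+n\|=\|m\|+\|n\|$ for $m\in M,n\in N$. $\ell^\infty(k)$ is $\mathbb{C}^k$ with the maximum norm. A uniform algebra is a closed subalgebra of $C(\Omega)$ (continuous complex functions on a compact Hausdorff space $\Omega$ with the supremum norm) that contains the constants and separates the points of $\Omega$. A functional $\phi\in X^*$ is norm-attaining if there is $x\in B(X)$ with $|\phi(x)|=\|\phi\|$. $X$ has property $(\dagger)$ if for every $0<\varepsilon<2$: whenever $\{\phi_\alpha\}$ is a net in $B(X^* )$ with $\|\phi_\alpha-\phi_\beta\|\ge\varepsilon$ for all $\alpha\ne\beta$, and $\phi\in B(X^* )$ satisfies $\phi_\alpha\to\phi$ in the weak* topology, then $\|\phi\|\le 1-\varepsilon/2$. Property $(\ddagger)$ is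 the same condition, but required only when all $\phi_\alpha$ and $\phi$ are norm-attaining. In these definitions nets are indexed by directed sets without a greatest element. *)

theory Defs
  imports "HOL-Analysis.Analysis" "HOL-Library.Function_Algebras"
begin

section \<open>Complex vector spaces\<close>

class complex_vector = real_vector +
  fixes scaleC :: "complex \<Rightarrow> 'a \<Rightarrow> 'a"  (infixr \<open>*\<^sub>C\<close> 75)
  assumes scaleC_add_right: "a *\<^sub>C (x + y) = a *\<^sub>C x + a *\<^sub>C y"
    and scaleC_add_left: "(a + b) *\<^sub>C x = a *\<^sub>C x + b *\<^sub>C x"
    and scaleC_scaleC: "a *\<^sub>C b *\<^sub>C x = (a * b) *\<^sub>C x"
    and scaleR_scaleC: "r *\<^sub>R x = complex_of_real r *\<^sub>C x"

class complex_normed_vector = complex_vector + real_normed_vector +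
  assumes norm_scaleC: "norm (a *\<^sub>C x) = cmod a * norm x"

lemma scaleC_one [simp]: "1 *\<^sub>C (x :: 'a :: complex_vector) = x"
  using scaleR_scaleC[of 1 x] by simp

global_interpretation complex_vector:
  vector_space "scaleC :: complex \<Rightarrow> 'a \<Rightarrow> 'a :: complex_vector"
  defines csubspace = complex_vector.subspace
    and cspan = complex_vector.span
  by standard (simp_all add: scaleC_add_right scaleC_add_left scaleC_scaleC)

instantiation complex :: complex_normed_vector
begin

definition scaleC_complex :: "complex \<Rightarrow> complex \<Rightarrow> complex" where
  "scaleC_complex = (*)"

instance
  by standard (simp_all add: scaleC_complex_def algebra_simps norm_mult scaleR_conv_of_real)

end

instantiation "fun" :: (type, real_vector) real_vector
begin

definition scaleR_fun :: "real \<Rightarrow> ('a \<Rightarrow> 'b) \<Rightarrow> 'a \<Rightarrow> 'b" where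
  "scaleR_fun r f = (\<lambda>x. r *\<^sub>R f x)"

instance
  by standard (simp_all add: scaleR_fun_def fun_eq_iff scaleR_add_right scaleR_add_left)

end

instantiation "fun" :: (type, complex_vector) complex_vector
begin

definition scaleC_fun :: "complex \<Rightarrow> ('a \<Rightarrow> 'b) \<Rightarrow> 'a \<Rightarrow> 'b" where
  "scaleC_fun c f = (\<lambda>x. c *\<^sub>C f x)"

instance
  by standard
    (simp_all add: scaleC_fun_def scaleR_fun_def fun_eq_iff scaleC_add_right scaleC_add_left
      scaleC_scaleC scaleR_scaleC)

end

lemma norm_bcontfun_SUP:
  "norm (f :: 'a :: topological_space \<Rightarrow>\<^sub>C 'b :: real_normed_vector) = (SUP x. norm (f x))"
  by (simp add: norm_bcontfun_def dist_bcontfun.rep_eq)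

instantiation bcontfun :: (topological_space, complex_normed_vector) complex_normed_vector
begin

definition scaleC_bcontfun :: "complex \<Rightarrow> ('a \<Rightarrow>\<^sub>C 'b) \<Rightarrow> 'a \<Rightarrow>\<^sub>C 'b" where
  "scaleC_bcontfun c f = Bcontfun (\<lambda>x. c *\<^sub>C f x)"

lemma scaleC_bcontfun_apply [simp]:
  fixes f :: "'a \<Rightarrow>\<^sub>C 'b"
  shows "(c *\<^sub>C f) x = c *\<^sub>C f x"
proof -
  have "bounded_linear (\<lambda>y :: 'b. c *\<^sub>C y)"
    by (rule bounded_linear_intro[of _ "cmod c"])
      (simp_all add: scaleC_add_right norm_scaleC scaleR_scaleC scaleC_scaleC mult.commute)
  from bounded_linear.continuous_on[OF this, of UNIV "apply_bcontfun f"]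
    bounded_linear_image[OF _ this, of "range (apply_bcontfun f)"]
  have "(\<lambda>x. c *\<^sub>C f x) \<in> bcontfun"
    unfolding bcontfun_def by (simp add: image_image)
  then show ?thesis
    by (simp add: scaleC_bcontfun_def Bcontfun_inverse)
qed

instance
proof
  fix a b :: complex and r :: real and f g :: "'a \<Rightarrow>\<^sub>C 'b"
  show "a *\<^sub>C (f + g) = a *\<^sub>C f + a *\<^sub>C g"
    by (rule bcontfun_eqI) (simp add: scaleC_add_right)
  show "(a + b) *\<^sub>C f = a *\<^sub>C f + b *\<^sub>C f"
    by (rule bcontfun_eqI) (simp add: scaleC_add_left)
  show "a *\<^sub>C b *\<^sub>C f = (a * b) *\<^sub>C f"
    by (rule bcontfun_eqI) (simp add: scaleC_scaleC)
  show "r *\<^sub>R f = complex_of_real r *\<^sub>C f"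
    by (rule bcontfun_eqI) (simp add: scaleR_scaleC)
  have "norm (a *\<^sub>C f) = norm (cmod a *\<^sub>R f)"
    by (simp add: norm_bcontfun_SUP scaleC_bcontfun_apply norm_scaleC)
  then show "norm (a *\<^sub>C f) = cmod a * norm f"
    by simp
qed

end

section \<open>The dual of a complex normed space\<close>

text \<open>
  A Banach space is a complete complex subspace \<open>X\<close> of an ambient complex normed space; the whole
  type is the case \<open>X = UNIV\<close>. A functional on \<open>X\<close> is represented by its extension by zero to the
  ambient type, so that distinct functionals on \<open>X\<close> are distinct functions.
\<close>

definition dual_space :: "'a :: complex_normed_vector set \<Rightarrow> ('a \<Rightarrow> complex) set" where
  "dual_space X = {f.
     (\<forall>x\<in>X. \<forall>y\<in>X. f (x + y) = f x + f y) \<and>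
     (\<forall>c. \<forall>x\<in>X. f (c *\<^sub>C x) = c * f x) \<and>
     (\<exists>K. \<forall>x\<in>X. cmod (f x) \<le> K * norm x) \<and>
     (\<forall>x. x \<notin> X \<longrightarrow> f x = 0)}"

definition dual_norm :: "'a :: complex_normed_vector set \<Rightarrow> ('a \<Rightarrow> complex) \<Rightarrow> real" where
  "dual_norm X f = (SUP x \<in> X \<inter> cball 0 1. cmod (f x))"

definition dual_ball :: "'a :: complex_normed_vector set \<Rightarrow> ('a \<Rightarrow> complex) set" where
  "dual_ball X = {f \<in> dual_space X. dual_norm X f \<le> 1}"

definition dual_sphere :: "'a :: complex_normed_vector set \<Rightarrow> ('a \<Rightarrow> complex) set" where
  "dual_sphere X = {f \<in> dual_space X. dual_norm X f = 1}"

definition dual_extreme_points :: "'a :: complex_normed_vector set \<Rightarrow> ('a \<Rightarrow> complex) set" where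
  "dual_extreme_points X = {f. f extreme_point_of dual_ball X}"

text \<open>
  The topology of the type \<open>'a \<Rightarrow> complex\<close> is the product topology. Functionals on \<open>X\<close> vanish
  off \<open>X\<close>, so on \<open>dual_space X\<close> it is the topology of pointwise convergence on \<open>X\<close>.
\<close>

definition weak_star :: "'a :: complex_normed_vector set \<Rightarrow> ('a \<Rightarrow> complex) topology" where
  "weak_star X = top_of_set (dual_space X)"

lemma limitin_weak_star_iff:
  "limitin (weak_star X) \<phi> \<psi> F \<longleftrightarrow>
     \<psi> \<in> dual_space X \<and> (\<forall>\<^sub>F i in F. \<phi> i \<in> dual_space X) \<and>
     (\<forall>x\<in>X. ((\<lambda>i. \<phi> i x) \<longlongrightarrow> \<psi> x) F)"
proof -
  have "((\<lambda>i. \<phi> i x) \<longlongrightarrow> \<psi> x) F"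
    if "\<psi> \<in> dual_space X" "\<forall>\<^sub>F i in F. \<phi> i \<in> dual_space X" "x \<notin> X" for x
  proof -
    have "\<forall>\<^sub>F i in F. \<psi> x = \<phi> i x"
      using that(2) by eventually_elim (use that in \<open>auto simp: dual_space_def\<close>)
    then show ?thesis by (rule Lim_transform_eventually[OF tendsto_const])
  qed
  moreover have "(\<phi> \<longlongrightarrow> \<psi>) F \<longleftrightarrow> (\<forall>x. ((\<lambda>i. \<phi> i x) \<longlongrightarrow> \<psi> x) F)"
    using limitin_componentwise[of "\<lambda>_ :: 'a. euclidean :: complex topology" UNIV \<phi> \<psi> F]
    by (simp add: euclidean_product_topology)
  ultimately show ?thesis
    by (auto simp: weak_star_def limitin_subtopology)
qed

definition norm_closed_subspace ::
    "'a :: complex_normed_vector set \<Rightarrow> ('a \<Rightarrow> complex) set \<Rightarrow> bool" where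
  "norm_closed_subspace X M \<longleftrightarrow> csubspace M \<and> M \<subseteq> dual_space X \<and>
     (\<forall>f\<in>dual_space X. (\<forall>e>0. \<exists>g\<in>M. dual_norm X (f - g) < e) \<longrightarrow> f \<in> M)"

definition L_summand :: "'a :: complex_normed_vector set \<Rightarrow> ('a \<Rightarrow> complex) set \<Rightarrow> bool" where
  "L_summand X M \<longleftrightarrow> norm_closed_subspace X M \<and>
     (\<exists>N. norm_closed_subspace X N \<and>
       M \<inter> N = {0} \<and>
       (\<forall>f\<in>dual_space X. \<exists>m\<in>M. \<exists>n\<in>N. f = m + n) \<and>
       (\<forall>m\<in>M. \<forall>n\<in>N. dual_norm X (m + n) = dual_norm X m + dual_norm X n))"

definition norm_attaining :: "'a :: complex_normed_vector set \<Rightarrow> ('a \<Rightarrow> complex) \<Rightarrow> bool" where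
  "norm_attaining X f \<longleftrightarrow> (\<exists>x \<in> X \<inter> cball 0 1. cmod (f x) = dual_norm X f)"

section \<open>Separated nets in the dual ball\<close>

definition directed_set :: "'i set \<Rightarrow> ('i \<Rightarrow> 'i \<Rightarrow> bool) \<Rightarrow> bool" where
  "directed_set I le \<longleftrightarrow> I \<noteq> {} \<and>
     (\<forall>i\<in>I. le i i) \<and>
     (\<forall>i\<in>I. \<forall>j\<in>I. \<forall>k\<in>I. le i j \<longrightarrow> le j k \<longrightarrow> le i k) \<and>
     (\<forall>i\<in>I. \<forall>j\<in>I. \<exists>k\<in>I. le i k \<and> le j k)"

definition has_greatest :: "'i set \<Rightarrow> ('i \<Rightarrow> 'i \<Rightarrow> bool) \<Rightarrow> bool" where
  "has_greatest I le \<longleftrightarrow> (\<exists>g\<in>I. \<forall>i\<in>I. le i g)"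

definition net_filter :: "'i set \<Rightarrow> ('i \<Rightarrow> 'i \<Rightarrow> bool) \<Rightarrow> 'i filter" where
  "net_filter I le = (INF i\<in>I. principal {j\<in>I. le i j})"

lemma eventually_net_filter:
  assumes "directed_set I le"
  shows "eventually P (net_filter I le) \<longleftrightarrow> (\<exists>i\<in>I. \<forall>j\<in>I. le i j \<longrightarrow> P j)"
proof -
  have "\<exists>k\<in>I. principal {l\<in>I. le k l} \<le> inf (principal {l\<in>I. le i l}) (principal {l\<in>I. le j l})"
    if ij: "i \<in> I" "j \<in> I" for i j
  proof -
    obtain k where k: "k \<in> I" "le i k" "le j k"
      using assms ij unfolding directed_set_def by metis
    have "le i l \<and> le j l" if "l \<in> I" "le k l" for l
      using assms that ij k unfolding directed_set_def by metis
    with k show ?thesis by auto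
  qed
  moreover have "I \<noteq> {}"
    using assms by (simp add: directed_set_def)
  ultimately have "eventually P (net_filter I le) \<longleftrightarrow>
      (\<exists>i\<in>I. eventually P (principal {j\<in>I. le i j}))"
    unfolding net_filter_def by (intro eventually_INF_base)
  then show ?thesis unfolding eventually_principal by (simp add: Ball_def imp_conjL)
qed

text \<open>
  The condition common to both properties, for nets and limits taken from a set \<open>F\<close> of functionals
  and index sets contained in the type \<open>'i\<close>.
\<close>

definition separated_nets_condition ::
    "'i itself \<Rightarrow> 'a :: complex_normed_vector set \<Rightarrow> ('a \<Rightarrow> complex) set \<Rightarrow> bool" where
  "separated_nets_condition _ X F \<longleftrightarrow>
     (\<forall>(\<epsilon> :: real) (I :: 'i set) le \<phi> \<psi>.
        0 < \<epsilon> \<and> \<epsilon> < 2 \<and> directed_set I le \<and> \<not> has_greatest I le \<and>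
        (\<forall>i\<in>I. \<phi> i \<in> dual_ball X \<inter> F) \<and>
        (\<forall>i\<in>I. \<forall>j\<in>I. i \<noteq> j \<longrightarrow> \<epsilon> \<le> dual_norm X (\<phi> i - \<phi> j)) \<and>
        \<psi> \<in> dual_ball X \<inter> F \<and>
        limitin (weak_star X) \<phi> \<psi> (net_filter I le)
        \<longrightarrow> dual_norm X \<psi> \<le> 1 - \<epsilon> / 2)"

text \<open>
  A net satisfying the separation hypothesis is injective, so its index set may be taken to be a
  set of functionals. Hence that index type covers all index types.
\<close>

lemma separated_nets_condition_any_index:
  fixes X :: "'a :: complex_normed_vector set"
  assumes cond: "separated_nets_condition TYPE('a \<Rightarrow> complex) X F" and zero: "0 \<in> X"
  shows "separated_nets_condition TYPE('i) X F"
  unfolding separated_nets_condition_def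
proof (intro allI impI, elim conjE)
  fix \<epsilon> :: real and I :: "'i set" and le \<phi> \<psi>
  assume eps: "0 < \<epsilon>" "\<epsilon> < 2" and dir: "directed_set I le" and ng: "\<not> has_greatest I le"
    and mem: "\<forall>i\<in>I. \<phi> i \<in> dual_ball X \<inter> F"
    and sep: "\<forall>i\<in>I. \<forall>j\<in>I. i \<noteq> j \<longrightarrow> \<epsilon> \<le> dual_norm X (\<phi> i - \<phi> j)"
    and psi: "\<psi> \<in> dual_ball X \<inter> F"
    and lim: "limitin (weak_star X) \<phi> \<psi> (net_filter I le)"
  have "dual_norm X (0 :: 'a \<Rightarrow> complex) = 0"
  proof -
    have "X \<inter> cball 0 1 \<noteq> {}" using zero by auto
    then show ?thesis unfolding dual_norm_def zero_fun_def by (simp add: image_constant_conv)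
  qed
  then have inj: "inj_on \<phi> I"
    using sep eps by (intro inj_onI) (metis diff_self not_le)
  define r where "r = inv_into I \<phi>"
  define le' where "le' f g = le (r f) (r g)" for f g
  have r: "r (\<phi> i) = i" if "i \<in> I" for i
    using that inj by (simp add: r_def)
  have dir': "directed_set (\<phi> ` I) le'"
    unfolding directed_set_def
  proof (intro conjI)
    show "\<phi> ` I \<noteq> {}" and "\<forall>f\<in>\<phi> ` I. le' f f"
      using dir by (auto simp: directed_set_def le'_def r)
    show "\<forall>f\<in>\<phi> ` I. \<forall>g\<in>\<phi> ` I. \<forall>h\<in>\<phi> ` I. le' f g \<longrightarrow> le' g h \<longrightarrow> le' f h"
    proof (intro ballI impI, elim imageE)
      fix f g h i j k
      assume "le' f g" "le' g h" "f = \<phi> i" "g = \<phi> j" "h = \<phi> k" "i \<in> I" "j \<in> I" "k \<in> I"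
      then show "le' f h"
        using dir unfolding directed_set_def le'_def by (metis r)
    qed
    show "\<forall>f\<in>\<phi> ` I. \<forall>g\<in>\<phi> ` I. \<exists>h\<in>\<phi> ` I. le' f h \<and> le' g h"
    proof (intro ballI, elim imageE)
      fix f g i j
      assume fg: "f = \<phi> i" "g = \<phi> j" "i \<in> I" "j \<in> I"
      then obtain k where "k \<in> I" "le i k" "le j k"
        using dir unfolding directed_set_def by metis
      with fg show "\<exists>h\<in>\<phi> ` I. le' f h \<and> le' g h"
        by (intro bexI[of _ "\<phi> k"]) (auto simp: le'_def r)
    qed
  qed
  have ng': "\<not> has_greatest (\<phi> ` I) le'"
    using ng unfolding has_greatest_def le'_def by (simp add: r)
  have ev: "eventually (\<lambda>f. f \<in> U) (net_filter (\<phi> ` I) le') \<longleftrightarrow>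
      eventually (\<lambda>i. \<phi> i \<in> U) (net_filter I le)" for U
    unfolding eventually_net_filter[OF dir] eventually_net_filter[OF dir']
    by (simp add: le'_def r)
  have "limitin (weak_star X) (\<lambda>f. f) \<psi> (net_filter (\<phi> ` I) le')"
    using lim unfolding limitin_def ev .
  moreover have "\<forall>f\<in>\<phi> ` I. \<forall>g\<in>\<phi> ` I. f \<noteq> g \<longrightarrow> \<epsilon> \<le> dual_norm X (f - g)"
    using sep by (intro ballI impI, elim imageE) auto
  moreover have "\<forall>f\<in>\<phi> ` I. f \<in> dual_ball X \<inter> F"
    using mem by blast
  ultimately show "dual_norm X \<psi> \<le> 1 - \<epsilon> / 2"
    using eps dir' ng' psi
    by (intro cond[unfolded separated_nets_condition_def, rule_format,
          of \<epsilon> "\<phi> ` I" le' "\<lambda>f. f" \<psi>] conjI)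
qed

definition property_dagger :: "'a :: complex_normed_vector set \<Rightarrow> bool" where
  "property_dagger X \<longleftrightarrow> separated_nets_condition TYPE('a \<Rightarrow> complex) X (dual_space X)"

definition property_ddagger :: "'a :: complex_normed_vector set \<Rightarrow> bool" where
  "property_ddagger X \<longleftrightarrow>
     separated_nets_condition TYPE('a \<Rightarrow> complex) X {f \<in> dual_space X. norm_attaining X f}"

section \<open>The spaces in the conclusions\<close>

definition isometric_spaces ::
    "'a :: complex_normed_vector set \<Rightarrow> 'b :: complex_normed_vector set \<Rightarrow> bool" where
  "isometric_spaces X Y \<longleftrightarrow> (\<exists>T. bij_betw T X Y \<and>
     (\<forall>x\<in>X. \<forall>y\<in>X. T (x + y) = T x + T y) \<and>
     (\<forall>c. \<forall>x\<in>X. T (c *\<^sub>C x) = c *\<^sub>C T x) \<and>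
     (\<forall>x\<in>X. norm (T x) = norm x))"

definition linfty :: "nat \<Rightarrow> (nat \<Rightarrow>\<^sub>C complex) set" where
  "linfty k = {v. \<forall>i\<ge>k. apply_bcontfun v i = 0}"

lemma norm_linfty:
  assumes "v \<in> linfty k" "k > 0"
  shows "norm v = Max ((\<lambda>i. cmod (v i)) ` {..<k})"
proof -
  have "cmod (v i) \<le> Max ((\<lambda>i. cmod (v i)) ` {..<k})" for i
  proof (cases "i < k")
    case True
    then show ?thesis by simp
  next
    case False
    have "0 \<le> cmod (v 0)" by simp
    also have "\<dots> \<le> Max ((\<lambda>i. cmod (v i)) ` {..<k})"
      using assms(2) by (intro Max_ge) auto
    finally show ?thesis using False assms(1) by (simp add: linfty_def)
  qed
  moreover have "Max ((\<lambda>i. cmod (v i)) ` {..<k}) \<in> (\<lambda>i. cmod (v i)) ` {..<k}"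
    using assms(2) by (intro Max_in) auto
  ultimately show ?thesis
    unfolding norm_bcontfun_SUP by (intro cSup_eq_maximum) auto
qed

definition finite_dimensional :: "'a :: complex_vector set \<Rightarrow> bool" where
  "finite_dimensional X \<longleftrightarrow> (\<exists>B. finite B \<and> B \<subseteq> X \<and> X = cspan B)"

text \<open>For compact \<open>'w\<close>, the type \<open>'w \<Rightarrow>\<^sub>C complex\<close> is the space of all continuous functions.\<close>

definition uniform_algebra :: "('w :: t2_space \<Rightarrow>\<^sub>C complex) set \<Rightarrow> bool" where
  "uniform_algebra A \<longleftrightarrow> compact (UNIV :: 'w set) \<and>
     closed A \<and> csubspace A \<and>
     (\<forall>f\<in>A. \<forall>g\<in>A. \<exists>h\<in>A. \<forall>x. apply_bcontfun h x = apply_bcontfun f x * apply_bcontfun g x) \<and>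
     (\<forall>c. const_bcontfun c \<in> A) \<and>
     (\<forall>x y. x \<noteq> y \<longrightarrow> (\<exists>f\<in>A. apply_bcontfun f x \<noteq> apply_bcontfun f y))"

end

theory Submission
  imports Defs
begin

text \<open>
  Both assertions rest on one fact: under a net condition of the kind \<open>(\<dagger>)\<close>, a weak* compact set \<open>K\<close>
  of admissible functionals of norm one has no infinite norm-separated subset
  (\<open>finite_separated_subset_of_sphere\<close>). If it had one, a net of separated functionals in \<open>K\<close> would
  converge to a point of \<open>K\<close>, whose norm is one although the condition makes it less than one.

  The difficulty is that a net with pairwise separated values is injective, so an accumulation point
  of the separated set is not enough: in nonmetrizable compact spaces a countable set may have no
  injective net converging to any point. The theorem \<open>compact_separated_injective_net\<close> resolves this
  for the distance given by the dual norm, which is weak* lower semicontinuous. Either the limit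
  sets of subsequences can be made small in norm, in which case diagonalising gives a convergent
  subsequence of the given set. Or they cannot, and then a Cantor scheme of neighbourhoods produces
  continuum many separated points in the closure of a countable set. Points of such a closure have
  neighbourhood bases of at most continuum many sets, so at a complete accumulation point one can
  choose distinct points of the continuum in all members of a base, and these form the net.

  For the first assertion, \<open>K\<close> is the weak* closure of the extreme points. Two extreme points that
  span different lines, one of which is an L-summand, are at distance two. So \<open>D\<close> meets
  only finitely many lines, and representatives \<open>f\<^sub>1, \<dots>, f\<^sub>k\<close> of them satisfy
  \<open>norm x = max \<bar>f\<^sub>i x\<bar>\<close>, by density of \<open>D\<close> and because every vector is normed by some extreme point. The
  \<open>f\<^sub>i\<close> are linearly independent, again by the L-decompositions, which gives the isometry onto
  \<open>\<ell>\<^sup>\<infinity>(k)\<close>. The functional analysis needed for this consists of the Hahn-Banach theorem (a minimal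
  sublinear functional is linear), the Banach-Alaoglu theorem, and the existence of norming extreme
  points (a minimal closed face is a point).

  For a uniform algebra, \<open>K\<close> consists of the point evaluations, which attain their norm at the
  constant \<open>1\<close>. Finitely many of them are \<open>1/2\<close>-dense in \<open>K\<close> for the norm and hence separate the
  vectors of the algebra, which is therefore finite-dimensional.
\<close>

section \<open>Separation axioms for product topologies\<close>

lemma open_coordinate_vimage:
  fixes U :: "'b :: topological_space set"
  assumes "open U"
  shows "open {f :: 'a \<Rightarrow> 'b. f i \<in> U}"
  using open_vimage[OF assms continuous_on_product_coordinates[of i]] by (simp add: vimage_def)

text \<open>
The weak* topology is a subspace topology of a product of copies of the complex plane. That such
products are regular is what lets neighbourhoods be replaced by their closures below.
\<close>

instance "fun" :: (type, t0_space) t0_space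
proof
  fix f g :: "'a \<Rightarrow> 'b" assume "f \<noteq> g"
  then obtain i where "f i \<noteq> g i" by auto
  then obtain U where "open U" "\<not> (f i \<in> U \<longleftrightarrow> g i \<in> U)" using separation_t0[of "f i" "g i"] by metis
  then show "\<exists>U. open U \<and> \<not> (f \<in> U \<longleftrightarrow> g \<in> U)"
    by (intro exI[of _ "{f. f i \<in> U}"]) (auto intro: open_coordinate_vimage)
qed

instance "fun" :: (type, t1_space) t1_space
proof
  fix f g :: "'a \<Rightarrow> 'b" assume "f \<noteq> g"
  then obtain i where "f i \<noteq> g i" by auto
  then obtain U where "open U" "f i \<in> U" "g i \<notin> U" using separation_t1[of "f i" "g i"] by metis
  then show "\<exists>U. open U \<and> f \<in> U \<and> g \<notin> U"
    by (intro exI[of _ "{f. f i \<in> U}"]) (auto intro: open_coordinate_vimage)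
qed

instance "fun" :: (type, t2_space) t2_space
proof
  fix f g :: "'a \<Rightarrow> 'b" assume "f \<noteq> g"
  then obtain i where "f i \<noteq> g i" by auto
  then obtain U V where "open U" "open V" "f i \<in> U" "g i \<in> V" "U \<inter> V = {}"
    using separation_t2[of "f i" "g i"] by metis
  then show "\<exists>U V. open U \<and> open V \<and> f \<in> U \<and> g \<in> V \<and> U \<inter> V = {}"
    by (intro exI[of _ "{f. f i \<in> U}"] exI[of _ "{f. f i \<in> V}"])
      (auto intro: open_coordinate_vimage)
qed

lemma regular_space_euclidean_t3:
  "regular_space (euclidean :: 'b :: t3_space topology)"
  unfolding regular_space_def
proof clarify
  fix C and a :: 'b assume "closedin euclidean C" "a \<notin> C"
  then obtain U V where "open U" "open V" "a \<in> U" "C \<subseteq> V" "U \<inter> V = {}"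
    using t3_space_class.t3_space[of C a] by auto
  then show "\<exists>U V. openin euclidean U \<and> openin euclidean V \<and> a \<in> U \<and> C \<subseteq> V \<and> disjnt U V"
    by (auto simp: disjnt_def)
qed

instance "fun" :: (type, t3_space) t3_space
proof
  fix C and f :: "'a \<Rightarrow> 'b" assume C: "closed C" "f \<notin> C"
  have "regular_space (euclidean :: ('a \<Rightarrow> 'b) topology)"
    unfolding euclidean_product_topology[symmetric] regular_space_product_topology
    using regular_space_euclidean_t3 by blast
  then have "\<exists>U V. openin euclidean U \<and> openin euclidean V \<and> f \<in> U \<and> C \<subseteq> V \<and> disjnt U V"
    using C unfolding regular_space_def by auto
  then show "\<exists>U V. open U \<and> open V \<and> f \<in> U \<and> C \<subseteq> V \<and> U \<inter> V = {}"
    by (auto simp: disjnt_def)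
qed

section \<open>Injective convergent nets in compact spaces\<close>

text \<open>
Indices are sets of points because the nets built below run through a base of neighbourhoods of
their limit. Injectivity matters: a net whose distinct indices carry functionals at distance at
least \<open>\<epsilon> > 0\<close> is injective, so mere membership of \<open>p\<close> in the closure of \<open>S\<close> would not produce
an admissible net.
\<close>

definition limit_of_injective_net :: "'b :: topological_space set \<Rightarrow> 'b \<Rightarrow> bool" where
  "limit_of_injective_net S p \<longleftrightarrow> (\<exists>(I :: 'b set set) le \<phi>.
     directed_set I le \<and> \<not> has_greatest I le \<and> inj_on \<phi> I \<and> \<phi> ` I \<subseteq> S \<and>
     (\<phi> \<longlongrightarrow> p) (net_filter I le))"

text \<open>
Well-order \<open>I\<close> in its cardinal type. Each index then has strictly fewer predecessors than \<open>I\<close> has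
elements, so the values already chosen cannot exhaust \<open>A i\<close>.
\<close>

lemma distinct_representatives:
  fixes A :: "'i \<Rightarrow> 'b set"
  assumes "\<And>i. i \<in> I \<Longrightarrow> I \<lesssim> A i"
  shows "\<exists>\<phi>. inj_on \<phi> I \<and> (\<forall>i\<in>I. \<phi> i \<in> A i)"
proof -
  include cardinal_syntax
  define r where "r = |I|"
  have r: "Card_order r" "Well_order r" "Field r = I"
    unfolding r_def by (rule card_of_Card_order card_of_Well_order Field_card_of)+
  define P where "P f x y \<longleftrightarrow> (x \<in> I \<longrightarrow> y \<in> A x \<and> y \<notin> f ` underS r x)" for f x and y :: 'b
  have "\<exists>\<phi>. \<forall>i. P \<phi> i (\<phi> i)"
  proof (rule dependent_wf_choice)
    show "wf (r - Id)"
      using r(2) by (simp add: well_order_on_def)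
    show "P f x y = P g x y" if "\<And>z. (z, x) \<in> r - Id \<Longrightarrow> f z = g z" for f g x and y
    proof -
      have "f ` underS r x = g ` underS r x"
        using that by (intro image_cong) (auto simp: underS_def)
      then show ?thesis by (simp add: P_def)
    qed
    show "\<exists>y. P f x y" for f x
    proof (cases "x \<in> I")
      case True
      have "|f ` underS r x| \<le>o |underS r x|" by (rule card_of_image)
      also have "|underS r x| <o r" using r True by (intro card_of_underS) auto
      also (ordLeq_ordLess_trans) have "r \<le>o |A x|"
        using assms[OF True] by (simp add: r_def card_of_ordLeq[symmetric] lepoll_def)
      finally (ordLess_ordLeq_trans) have "\<not> A x \<subseteq> f ` underS r x"
        using card_of_mono1 not_ordLess_ordLeq by blast
      then show ?thesis by (auto simp: P_def)
    qed (simp add: P_def)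
  qed
  then obtain \<phi> where \<phi>: "\<And>i. i \<in> I \<Longrightarrow> \<phi> i \<in> A i \<and> \<phi> i \<notin> \<phi> ` underS r i"
    by (auto simp: P_def)
  have "\<phi> i \<noteq> \<phi> j" if "i \<in> I" "j \<in> I" "i \<noteq> j" for i j
  proof -
    have "(i, j) \<in> r \<or> (j, i) \<in> r"
      using r that unfolding well_order_on_def linear_order_on_def total_on_def by blast
    then have "i \<in> underS r j \<or> j \<in> underS r i" using that by (auto simp: underS_def)
    then show ?thesis using \<phi> that by (metis imageI)
  qed
  then have "inj_on \<phi> I" by (auto simp: inj_on_def)
  with \<phi> show ?thesis by (intro exI[of _ \<phi>]) simp
qed

text \<open>
A base of neighbourhoods (or just of sets shrinking to \<open>p\<close>), ordered by reverse inclusion, is the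
index set; distinct representatives of the sets \<open>S \<inter> B\<close> make the net injective. A greatest index
would be contained in every member of the base, hence in \<open>{p}\<close>, yet it meets \<open>S\<close> in an infinite
set.
\<close>

lemma injective_net_from_base:
  fixes p :: "'b :: t2_space"
  assumes base: "\<And>U. open U \<Longrightarrow> p \<in> U \<Longrightarrow> \<exists>B\<in>\<B>. B \<subseteq> U"
    and int: "\<And>B C. B \<in> \<B> \<Longrightarrow> C \<in> \<B> \<Longrightarrow> \<exists>E\<in>\<B>. E \<subseteq> B \<inter> C"
    and inf: "\<And>B. B \<in> \<B> \<Longrightarrow> infinite (S \<inter> B)"
    and card: "\<And>B. B \<in> \<B> \<Longrightarrow> \<B> \<lesssim> S \<inter> B"
  shows "limit_of_injective_net S p"
proof -
  obtain \<phi> where \<phi>: "inj_on \<phi> \<B>" "\<And>B. B \<in> \<B> \<Longrightarrow> \<phi> B \<in> S \<inter> B"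
    using distinct_representatives[of \<B> "\<lambda>B. S \<inter> B"] card by blast
  have dir: "directed_set \<B> (\<lambda>B C. C \<subseteq> B)"
    using base[of UNIV] int unfolding directed_set_def by fastforce
  have "\<not> has_greatest \<B> (\<lambda>B C. C \<subseteq> B)"
  proof
    assume "has_greatest \<B> (\<lambda>B C. C \<subseteq> B)"
    then obtain G where G: "G \<in> \<B>" "\<And>B. B \<in> \<B> \<Longrightarrow> G \<subseteq> B"
      unfolding has_greatest_def by blast
    have "G \<subseteq> {p}"
    proof
      fix s assume "s \<in> G"
      show "s \<in> {p}"
      proof (rule ccontr)
        assume "s \<notin> {p}"
        then obtain U where "open U" "p \<in> U" "s \<notin> U"
          using separation_t1[of p s] by auto
        then show False using base G \<open>s \<in> G\<close> by blast
      qed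
    qed
    then show False using inf[OF G(1)] by (meson finite.simps finite_Int finite_subset)
  qed
  moreover have "(\<phi> \<longlongrightarrow> p) (net_filter \<B> (\<lambda>B C. C \<subseteq> B))"
  proof (rule topological_tendstoI)
    fix U assume "open U" "p \<in> U"
    then obtain B where "B \<in> \<B>" "B \<subseteq> U" using base by blast
    then show "\<forall>\<^sub>F C in net_filter \<B> (\<lambda>B C. C \<subseteq> B). \<phi> C \<in> U"
      using \<phi>(2) unfolding eventually_net_filter[OF dir] by blast
  qed
  ultimately show ?thesis
    unfolding limit_of_injective_net_def using dir \<phi> by blast
qed

text \<open>
Otherwise \<open>K\<close> is covered by finitely many open sets each meeting \<open>S\<close> in fewer than \<open>|S|\<close> points,
and a finite union of sets of cardinality below the infinite cardinal \<open>|S|\<close> is again that small.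
\<close>

lemma complete_accumulation_point:
  fixes K :: "'b :: topological_space set"
  assumes "compact K" "S \<subseteq> K" "infinite S"
  obtains p where "p \<in> K" "\<And>U. open U \<Longrightarrow> p \<in> U \<Longrightarrow> S \<lesssim> S \<inter> U"
proof -
  include cardinal_syntax
  have less: "|T| <o |S| \<longleftrightarrow> \<not> S \<lesssim> T" for T :: "'b set"
    by (metis card_of_ordLeq card_of_Well_order not_ordLeq_iff_ordLess lepoll_def)
  have "\<exists>p\<in>K. \<forall>U. open U \<longrightarrow> p \<in> U \<longrightarrow> S \<lesssim> S \<inter> U"
  proof (rule ccontr)
    assume "\<not> ?thesis"
    then obtain U where U: "\<And>p. p \<in> K \<Longrightarrow> open (U p) \<and> p \<in> U p \<and> \<not> S \<lesssim> S \<inter> U p"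
      by metis
    obtain F where F: "F \<subseteq> K" "finite F" "K \<subseteq> (\<Union>p\<in>F. U p)"
    proof (rule compactE_image[OF \<open>compact K\<close>, of K U])
      show "K \<subseteq> (\<Union>p\<in>K. U p)" using U by fast
    qed (use U in auto)
    have "|S \<inter> (\<Union>p\<in>F. U p)| <o |S|"
      using F(2,1)
    proof (induction F)
      case empty
      then show ?case using assms by (auto simp: less)
    next
      case (insert p F)
      then have "|(S \<inter> U p) \<union> (S \<inter> (\<Union>p\<in>F. U p))| <o |S|"
        using U assms by (intro card_of_Un_ordLess_infinite) (auto simp: less)
      then show ?case by (simp add: Int_Un_distrib)
    qed
    moreover have "S \<inter> (\<Union>p\<in>F. U p) = S" using F assms by blast
    ultimately show False by (simp add: less)
  qed
  then show ?thesis using that by blast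
qed

lemma compact_decreasing_Inter_nonempty:
  fixes F :: "nat \<Rightarrow> 'b :: topological_space set"
  assumes "compact K" "\<And>n. closed (F n)" "\<And>n. F n \<noteq> {}" "\<And>n. F n \<subseteq> K" "decseq F"
  shows "(\<Inter>n. F n) \<noteq> {}"
proof -
  have "K \<inter> (\<Inter>n\<in>UNIV. F n) \<noteq> {}"
  proof (rule compact_imp_fip_image)
    fix I :: "nat set" assume "finite I"
    then obtain m where "\<forall>i\<in>I. i \<le> m" by (meson finite_nat_set_iff_bounded_le)
    then have "F m \<subseteq> K \<inter> (\<Inter>i\<in>I. F i)"
      using assms(4)[of m] decseqD[OF assms(5)] by blast
    then show "K \<inter> (\<Inter>i\<in>I. F i) \<noteq> {}" using assms(3)[of m] by blast
  qed (use assms in auto)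
  then show ?thesis by blast
qed

text \<open>
By regularity, \<open>p\<close> has a neighbourhood base in \<open>closure T\<close> consisting of closures of subsets of the
countable set \<open>T\<close>. It has at most continuum many members, and at a complete accumulation point of
\<open>S\<close> each of them contains at least continuum many points of \<open>S\<close>.
\<close>

lemma limit_of_continuum_in_separable_compact:
  fixes K T S :: "'b :: t3_space set"
  assumes K: "compact K" and T: "countable T" "T \<subseteq> K"
    and S: "(UNIV :: (nat \<Rightarrow> bool) set) \<lesssim> S" "S \<subseteq> closure T"
  obtains p where "p \<in> K" "limit_of_injective_net S p"
proof -
  have ST: "S \<subseteq> K"
    using S T K closure_minimal compact_imp_closed by blast
  have c: "(UNIV :: nat set set) \<lesssim> S"
  proof -
    have "inj (\<lambda>A n. (n :: nat) \<in> A)" by (auto simp: inj_on_def fun_eq_iff)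
    then have "(UNIV :: nat set set) \<lesssim> (UNIV :: (nat \<Rightarrow> bool) set)"
      unfolding lepoll_def by blast
    then show ?thesis using S(1) lepoll_trans by blast
  qed
  have infS: "infinite S"
    unfolding infinite_le_lepoll
    using lepoll_Pow_self[of "UNIV :: nat set"] c lepoll_trans by (metis Pow_UNIV)
  obtain p where p: "p \<in> K" "\<And>U. open U \<Longrightarrow> p \<in> U \<Longrightarrow> S \<lesssim> S \<inter> U"
    using complete_accumulation_point[OF K ST infS] by blast
  define \<B> where "\<B> = (\<lambda>U. closure (T \<inter> U)) ` {U. open U \<and> p \<in> U}"
  have big: "S \<lesssim> S \<inter> B" if B: "B \<in> \<B>" for B
  proof -
    obtain U where U: "open U" "p \<in> U" "B = closure (T \<inter> U)"
      using B unfolding \<B>_def by blast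
    have "S \<inter> U \<subseteq> S \<inter> B"
      using open_Int_closure_subset[OF U(1), of T] S(2) U(3) by (auto simp: Int_commute)
    then show ?thesis using p(2)[OF U(1,2)] lepoll_trans subset_imp_lepoll by blast
  qed
  have "limit_of_injective_net S p"
  proof (rule injective_net_from_base)
    fix U assume U: "open U" "p \<in> U"
    then obtain V W where VW: "open V" "open W" "p \<in> V" "- U \<subseteq> W" "V \<inter> W = {}"
      using t3_space_class.t3_space[of "- U" p] by auto
    then have "closure (T \<inter> V) \<subseteq> - W" by (intro closure_minimal) auto
    then show "\<exists>B\<in>\<B>. B \<subseteq> U" using VW by (auto simp: \<B>_def)
  next
    fix B C assume "B \<in> \<B>" "C \<in> \<B>"
    then obtain U V where UV: "open U" "p \<in> U" "B = closure (T \<inter> U)" "open V" "p \<in> V" "C = closure (T \<inter> V)"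
      unfolding \<B>_def by blast
    have "closure (T \<inter> (U \<inter> V)) \<in> \<B>"
      using UV unfolding \<B>_def by (intro imageI) auto
    moreover have "closure (T \<inter> (U \<inter> V)) \<subseteq> closure (T \<inter> U)"
        "closure (T \<inter> (U \<inter> V)) \<subseteq> closure (T \<inter> V)"
      by (intro closure_mono; blast)+
    ultimately show "\<exists>E\<in>\<B>. E \<subseteq> B \<inter> C" using UV(3,6) by blast
  next
    fix B assume B: "B \<in> \<B>"
    show "infinite (S \<inter> B)" using big[OF B] infS unfolding infinite_le_lepoll by (blast intro: lepoll_trans)
    have "\<B> \<subseteq> closure ` Pow T" by (auto simp: \<B>_def)
    then have "\<B> \<lesssim> Pow T" by (rule subset_image_lepoll)
    also have "Pow T \<lesssim> (UNIV :: nat set set)"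
      unfolding lepoll_def
    proof (intro exI conjI)
      show "inj_on (image (to_nat_on T)) (Pow T)"
        using T(1) by (intro inj_on_image_Pow inj_on_to_nat_on)
    qed auto
    also note c
    also note big[OF B]
    finally show "\<B> \<lesssim> S \<inter> B" .
  qed
  with p(1) show ?thesis using that by blast
qed

text \<open>
Repeatedly shrinking \<open>T\<close> and diagonalising gives a sequence \<open>t\<close> all of whose limit points are at
\<open>d\<close>-distance zero from each other. The limit point is therefore unique, and by compactness the
sequence converges to it; its tails serve as the base.
\<close>

lemma limit_of_shrinking_limit_sets:
  fixes K T :: "'b :: t2_space set" and d :: "'b \<Rightarrow> 'b \<Rightarrow> real"
  assumes K: "compact K" and T: "T \<subseteq> K" "infinite T"
    and small: "\<And>A e. A \<subseteq> T \<Longrightarrow> infinite A \<Longrightarrow> e > 0 \<Longrightarrow>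
      \<exists>B\<subseteq>A. infinite B \<and> (\<forall>u v. u islimpt B \<longrightarrow> v islimpt B \<longrightarrow> d u v \<le> e)"
    and d_pos: "\<And>u v. u \<in> K \<Longrightarrow> v \<in> K \<Longrightarrow> d u v \<le> 0 \<Longrightarrow> u = v"
  obtains p where "p \<in> K" "limit_of_injective_net T p"
proof -
  have "\<exists>B. A \<subseteq> T \<and> infinite A \<and> e > 0 \<longrightarrow>
      B \<subseteq> A \<and> infinite B \<and> (\<forall>u v. u islimpt B \<longrightarrow> v islimpt B \<longrightarrow> d u v \<le> e)" for A e
    using small[of A e] by auto
  then obtain g where "\<And>A e. A \<subseteq> T \<and> infinite A \<and> e > 0 \<longrightarrow>
      g A e \<subseteq> A \<and> infinite (g A e) \<and>
      (\<forall>u v. u islimpt g A e \<longrightarrow> v islimpt g A e \<longrightarrow> d u v \<le> e)"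
    by metis
  then have g: "g A e \<subseteq> A" "infinite (g A e)"
      "\<And>u v. u islimpt g A e \<Longrightarrow> v islimpt g A e \<Longrightarrow> d u v \<le> e"
    if "A \<subseteq> T" "infinite A" "e > 0" for A e
    using that by simp_all
  define F where "F = rec_nat T (\<lambda>n A. g A (1 / real (Suc n)))"
  have F_0: "F 0 = T" and F_Suc: "F (Suc n) = g (F n) (1 / real (Suc n))" for n
    by (simp_all add: F_def)
  have F: "F n \<subseteq> T \<and> infinite (F n)" for n
  proof (induction n)
    case (Suc n)
    then show ?case using g(1,2)[of "F n" "1 / real (Suc n)"] by (simp add: F_Suc) blast
  qed (simp add: F_0 T)
  have dec: "decseq F"
    unfolding decseq_Suc_iff F_Suc using F g(1) by simp
  \<comment> \<open>The diagonal sequence: one new point from each \<open>F n\<close>.\<close>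
  have "\<exists>t. \<forall>n::nat. t n \<in> F n \<and> t n \<notin> t ` {..<n}"
  proof (rule dependent_wellorder_choice)
    fix n :: nat and t :: "nat \<Rightarrow> 'b"
    have "infinite (F n - t ` {..<n})" using F by (intro Diff_infinite_finite) auto
    then have "F n - t ` {..<n} \<noteq> {}" by (rule infinite_imp_nonempty)
    then show "\<exists>r. r \<in> F n \<and> r \<notin> t ` {..<n}" by blast
  next
    fix r n and t s :: "nat \<Rightarrow> 'b" assume "\<And>m. m < n \<Longrightarrow> t m = s m"
    then have "t ` {..<n} = s ` {..<n}" by (intro image_cong) auto
    then show "(r \<in> F n \<and> r \<notin> t ` {..<n}) = (r \<in> F n \<and> r \<notin> s ` {..<n})" by simp
  qed
  then obtain t where t: "\<And>n. t n \<in> F n" "\<And>n. t n \<notin> t ` {..<n}" by blast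
  have inj: "inj t"
  proof (rule linorder_injI)
    fix m n :: nat assume "m < n"
    then show "t m \<noteq> t n" using t(2)[of n] by (metis imageI lessThan_iff)
  qed
  have tK: "range t \<subseteq> K" and tT: "range t \<subseteq> T" using t(1) F T by blast+
  have unique: "u = v" if "u islimpt range t" "v islimpt range t" "u \<in> K" "v \<in> K" for u v
  proof (rule d_pos)
    have lim: "w islimpt F n" if "w islimpt range t" for w n
    proof -
      \<comment> \<open>Limit points ignore finitely many terms, and the rest of the sequence lies in \<open>F n\<close>.\<close>
      have "t m \<in> t ` {..<n} \<union> F n" for m
        using t(1)[of m] decseqD[OF dec, of n m] by (cases "m < n") auto
      then have "w islimpt t ` {..<n} \<union> F n"
        using that by (elim islimpt_subset) auto
      then show ?thesis by (simp add: islimpt_Un_finite)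
    qed
    have "d u v \<le> 1 / real (Suc n)" for n
      using g(3)[of "F n" "1 / real (Suc n)" u v] F[of n]
        lim[OF that(1), of "Suc n"] lim[OF that(2), of "Suc n"] unfolding F_Suc by simp
    then have "d u v \<le> inverse (real (Suc n))" for n by (simp add: inverse_eq_divide)
    then show "d u v \<le> 0"
      by (intro LIMSEQ_le_const[OF LIMSEQ_inverse_real_of_nat]) auto
  qed (use that in auto)
  obtain p where p: "p \<in> K" "p islimpt range t"
    using Heine_Borel_imp_Bolzano_Weierstrass[OF K _ tK] range_inj_infinite[OF inj] by blast
  have tail: "\<exists>n. t ` {n..} \<subseteq> U" if U: "open U" "p \<in> U" for U
  proof -
    have "finite (range t - U)"
    proof (rule ccontr)
      assume "infinite (range t - U)"
      then obtain q where q: "q \<in> K - U" "q islimpt range t - U"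
        using Heine_Borel_imp_Bolzano_Weierstrass[OF compact_diff[OF K U(1)], of "range t - U"] tK
        by blast
      then have "q islimpt range t" by (elim islimpt_subset) auto
      then show False using unique[of p q] p q U by blast
    qed
    then have "finite (t -` (range t - U))" using inj by (intro finite_vimageI)
    then obtain n where n: "\<forall>m\<in>t -` (range t - U). m < n"
      using finite_nat_set_iff_bounded by blast
    have "t m \<in> U" if "n \<le> m" for m
      using bspec[OF n, of m] that by auto
    then show ?thesis by (intro exI[of _ n]) auto
  qed
  have "limit_of_injective_net T p"
  proof (rule injective_net_from_base)
    let ?B = "range (\<lambda>n. t ` {n..})"
    show "\<exists>B\<in>?B. B \<subseteq> U" if "open U" "p \<in> U" for U
      using tail[OF that] by blast
    fix B assume "B \<in> ?B"
    then obtain n where n: "B = t ` {n..}" by blast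
    show inf: "infinite (T \<inter> B)"
    proof -
      have "T \<inter> B = t ` {n..}" using n tT by blast
      then show ?thesis using inj by (simp add: finite_image_iff inj_on_subset infinite_Ici)
    qed
    have "?B \<lesssim> (UNIV :: nat set)" by (rule image_lepoll)
    also have "(UNIV :: nat set) \<lesssim> T \<inter> B" using inf by (simp add: infinite_le_lepoll)
    finally show "?B \<lesssim> T \<inter> B" .
    fix C assume "C \<in> ?B"
    then obtain m where m: "C = t ` {m..}" by blast
    have "t ` {max m n..} \<subseteq> B \<inter> C" using n m by auto
    then show "\<exists>E\<in>?B. E \<subseteq> B \<inter> C" by blast
  qed
  with p(1) show ?thesis using that by blast
qed

text \<open>
A Cantor scheme. Two limit points of \<open>A\<close> at distance more than \<open>e\<close> have neighbourhoods whose
closures are \<open>e\<close>-separated, and each neighbourhood meets \<open>A\<close> in an infinite set. Iterating yields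
infinite sets indexed by the nodes of the binary tree. A point in the intersection of the closures
along each branch gives a continuum of \<open>e\<close>-separated points, all in the closure of the countable set
\<open>T\<close>, so the cardinality argument for separable compact sets applies.
\<close>

lemma limit_of_separated_continuum:
  fixes K T :: "'b :: t3_space set" and d :: "'b \<Rightarrow> 'b \<Rightarrow> real"
  assumes K: "compact K" and T: "T \<subseteq> K" "infinite T" "countable T" and e: "e > 0"
    and split: "\<And>A. A \<subseteq> T \<Longrightarrow> infinite A \<Longrightarrow> \<exists>u v. u islimpt A \<and> v islimpt A \<and> e < d u v"
    and lsc: "\<And>u v. u \<in> K \<Longrightarrow> v \<in> K \<Longrightarrow> e < d u v \<Longrightarrow>
      \<exists>U V. open U \<and> open V \<and> u \<in> U \<and> v \<in> V \<and>
        (\<forall>u'\<in>K \<inter> closure U. \<forall>v'\<in>K \<inter> closure V. e \<le> d u' v')"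
    and d_sym: "\<And>u v. u \<in> K \<Longrightarrow> v \<in> K \<Longrightarrow> d u v = d v u"
    and d_self: "\<And>u. u \<in> K \<Longrightarrow> d u u = 0"
  obtains S p where "S \<subseteq> K" "p \<in> K" "\<And>u v. u \<in> S \<Longrightarrow> v \<in> S \<Longrightarrow> u \<noteq> v \<Longrightarrow> e \<le> d u v"
    "limit_of_injective_net S p"
proof -
  have limK: "u \<in> K" if "u islimpt A" "A \<subseteq> T" for u A
    using islimpt_subset[OF that(1), of K] that(2) T(1) compact_imp_closed[OF K]
    by (auto simp: closed_limpt)
  have "\<forall>A. \<exists>U V. A \<subseteq> T \<and> infinite A \<longrightarrow> infinite (A \<inter> U) \<and> infinite (A \<inter> V) \<and>
      (\<forall>u\<in>K \<inter> closure U. \<forall>v\<in>K \<inter> closure V. e \<le> d u v)"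
    (is "\<forall>A. \<exists>U V. ?Q A U V")
  proof
    fix A show "\<exists>U V. ?Q A U V"
    proof (cases "A \<subseteq> T \<and> infinite A")
      case True
      then have A: "A \<subseteq> T" "infinite A" by auto
      obtain u v where uv: "u islimpt A" "v islimpt A" "e < d u v"
        using split[OF A] by blast
      then obtain U V where UV: "open U" "open V" "u \<in> U" "v \<in> V"
          "\<forall>u'\<in>K \<inter> closure U. \<forall>v'\<in>K \<inter> closure V. e \<le> d u' v'"
        using lsc[OF limK[OF uv(1) A(1)] limK[OF uv(2) A(1)] uv(3)] by (elim exE conjE)
      have "infinite (U \<inter> A)"
        using uv(1) UV(1,3) unfolding islimpt_eq_acc_point by blast
      moreover have "infinite (V \<inter> A)"
        using uv(2) UV(2,4) unfolding islimpt_eq_acc_point by blast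
      ultimately show ?thesis using UV(5) by (intro exI[of _ U] exI[of _ V]) (simp add: Int_commute)
    qed auto
  qed
  from choice[OF this] obtain U where "\<forall>A. \<exists>V. ?Q A (U A) V" by (elim exE)
  from choice[OF this] obtain V where "\<forall>A. ?Q A (U A) (V A)" by (elim exE)
  then have UV: "infinite (A \<inter> U A)" "infinite (A \<inter> V A)"
      "\<And>u v. u \<in> K \<inter> closure (U A) \<Longrightarrow> v \<in> K \<inter> closure (V A) \<Longrightarrow> e \<le> d u v"
    if "A \<subseteq> T" "infinite A" for A
    using that by simp_all
  \<comment> \<open>\<open>R b n\<close> is the node of level \<open>n\<close> on the branch \<open>b\<close>; it depends only on the first \<open>n\<close> bits of \<open>b\<close>.\<close>
  define R where "R b = rec_nat T (\<lambda>n A. A \<inter> (if b n then U A else V A))" for b :: "nat \<Rightarrow> bool"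
  have R_0: "R b 0 = T" and R_Suc: "R b (Suc n) = R b n \<inter> (if b n then U (R b n) else V (R b n))"
    for b n by (simp_all add: R_def)
  have R: "R b n \<subseteq> T \<and> infinite (R b n)" for b n
  proof (induction n)
    case (Suc n)
    then show ?case using UV(1,2)[of "R b n"] by (auto simp: R_Suc)
  qed (simp add: R_0 T)
  have dec: "decseq (\<lambda>n. closure (R b n))" for b
    unfolding decseq_Suc_iff by (intro allI closure_mono) (simp add: R_Suc)
  have clK: "closure (R b n) \<subseteq> K" for b n
    using R T K by (meson closure_minimal compact_imp_closed subset_trans)
  have "(\<Inter>n. closure (R b n)) \<noteq> {}" for b
    using R clK dec by (intro compact_decreasing_Inter_nonempty[OF K]) (auto simp: infinite_imp_nonempty)
  then have "\<forall>b. \<exists>k. k \<in> (\<Inter>n. closure (R b n))" by blast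
  from choice[OF this] obtain k where k: "\<And>b n. k b \<in> closure (R b n)" by blast
  have kK: "k b \<in> K" for b using k[of b 0] clK[of b 0] by blast
  have sep: "e \<le> d (k b) (k c)" if neq: "b \<noteq> c" for b c
  proof -
    obtain m where "b m \<noteq> c m" using neq by auto
    \<comment> \<open>At the first bit where two branches differ they leave a common node through its two separated parts.\<close>
    define n where "n = (LEAST n. b n \<noteq> c n)"
    have bn: "b n \<noteq> c n" unfolding n_def by (rule LeastI) fact
    have "b m = c m" if "m < n" for m using not_less_Least[of m "\<lambda>n. b n \<noteq> c n"] that unfolding n_def by blast
    then have "R b m = R c m" if "m \<le> n" for m
      using that by (induction m) (simp_all add: R_0 R_Suc)
    then have same: "R c n = R b n" by simp
    have in_U: "k a \<in> K \<inter> closure (U (R a n))" if "a n" for a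
      using k[of a "Suc n"] that kK closure_mono[of "R a (Suc n)" "U (R a n)"] by (auto simp: R_Suc)
    have in_V: "k a \<in> K \<inter> closure (V (R a n))" if "\<not> a n" for a
      using k[of a "Suc n"] that kK closure_mono[of "R a (Suc n)" "V (R a n)"] by (auto simp: R_Suc)
    show ?thesis
    proof (cases "b n")
      case True
      then show ?thesis using UV(3)[of "R b n" "k b" "k c"] R in_U[of b] in_V[of c] bn same by simp
    next
      case False
      then show ?thesis
        using UV(3)[of "R b n" "k c" "k b"] R in_U[of c] in_V[of b] bn same d_sym[OF kK kK] by simp
    qed
  qed
  have "inj k"
  proof (rule injI, rule ccontr)
    fix b c assume "k b = k c" "b \<noteq> c"
    then show False using sep[of b c] d_self[OF kK] e by simp
  qed
  then have card: "(UNIV :: (nat \<Rightarrow> bool) set) \<lesssim> range k" unfolding lepoll_def by blast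
  have sub: "range k \<subseteq> closure T" using k[of _ 0] by (auto simp: R_0)
  obtain p where p: "p \<in> K" "limit_of_injective_net (range k) p"
    using limit_of_continuum_in_separable_compact[OF K T(3,1) card sub] by blast
  show ?thesis
  proof (rule that)
    show "range k \<subseteq> K" using sub clK[of _ 0] by (auto simp: R_0)
    show "e \<le> d u v" if "u \<in> range k" "v \<in> range k" "u \<noteq> v" for u v
      using that by (auto intro: sep)
  qed (use p in auto)
qed

text \<open>
The dichotomy behind the main theorem: in a compact set whose points are compared by a lower
semicontinuous distance \<open>d\<close>, an infinite separated subset always yields a convergent \<^emph>\<open>injective\<close> net
of points that are still uniformly separated, though perhaps with a smaller constant and with
different points. For instance, an infinite discrete sequence in the Stone-Cech compactification of
the natural numbers has no convergent subsequence, so a countable set cannot be expected to carry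
such a net itself. Either every infinite subset of a fixed countable separated set can be thinned
out until its limit points are as close as one likes, and then a subsequence converges; or some
infinite subset resists this at a fixed scale, and then it generates a separated continuum. Lower
semicontinuity is stated with closures of neighbourhoods so that the separation of two neighbourhoods
passes to the limits of points in them.
\<close>

theorem compact_separated_injective_net:
  fixes K T :: "'b :: t3_space set" and d :: "'b \<Rightarrow> 'b \<Rightarrow> real"
  assumes K: "compact K" and T: "T \<subseteq> K" "infinite T" and e: "e > 0"
    and sep: "\<And>u v. u \<in> T \<Longrightarrow> v \<in> T \<Longrightarrow> u \<noteq> v \<Longrightarrow> e \<le> d u v"
    and lsc: "\<And>u v r. u \<in> K \<Longrightarrow> v \<in> K \<Longrightarrow> r < d u v \<Longrightarrow>
      \<exists>U V. open U \<and> open V \<and> u \<in> U \<and> v \<in> V \<and>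
        (\<forall>u'\<in>K \<inter> closure U. \<forall>v'\<in>K \<inter> closure V. r \<le> d u' v')"
    and d_sym: "\<And>u v. u \<in> K \<Longrightarrow> v \<in> K \<Longrightarrow> d u v = d v u"
    and d_self: "\<And>u. u \<in> K \<Longrightarrow> d u u = 0"
    and d_pos: "\<And>u v. u \<in> K \<Longrightarrow> v \<in> K \<Longrightarrow> d u v \<le> 0 \<Longrightarrow> u = v"
  obtains r S p where "r > 0" "S \<subseteq> K" "p \<in> K"
    "\<And>u v. u \<in> S \<Longrightarrow> v \<in> S \<Longrightarrow> u \<noteq> v \<Longrightarrow> r \<le> d u v" "limit_of_injective_net S p"
proof -
  obtain T' where T': "T' \<subseteq> T" "infinite T'" "countable T'"
    using infinite_countable_subset'[OF T(2)] by blast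
  show ?thesis
  proof (cases "\<forall>A r. A \<subseteq> T' \<longrightarrow> infinite A \<longrightarrow> r > 0 \<longrightarrow>
      (\<exists>B\<subseteq>A. infinite B \<and> (\<forall>u v. u islimpt B \<longrightarrow> v islimpt B \<longrightarrow> d u v \<le> r))")
    case True
    have "T' \<subseteq> K" using T T' by blast
    then obtain p where "p \<in> K" "limit_of_injective_net T' p"
      using limit_of_shrinking_limit_sets[OF K _ T'(2), of d] True d_pos by blast
    then show ?thesis using that[of e T' p] T' T sep e by blast
  next
    case False
    then obtain A r where A: "A \<subseteq> T'" "infinite A" "r > 0"
      and split: "\<And>B. B \<subseteq> A \<Longrightarrow> infinite B \<Longrightarrow> \<exists>u v. u islimpt B \<and> v islimpt B \<and> r < d u v"
      by (simp only: not_all not_imp not_ex not_not de_Morgan_conj not_le) (metis)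
    have "A \<subseteq> K" "countable A" using A T T' countable_subset by blast+
    then obtain S p where "S \<subseteq> K" "p \<in> K" "\<And>u v. u \<in> S \<Longrightarrow> v \<in> S \<Longrightarrow> u \<noteq> v \<Longrightarrow> r \<le> d u v"
        "limit_of_injective_net S p"
      using limit_of_separated_continuum[OF K _ A(2) _ A(3) split lsc d_sym d_self] by blast
    then show ?thesis using that[of r S p] A(3) by blast
  qed
qed

section \<open>The Hahn-Banach theorem\<close>

text \<open>
One inequality in the homogeneity clause gives equality: for \<open>t > 0\<close> apply it also to the inverse
of \<open>t\<close>. This form is easier to verify for infima.
\<close>

definition sublinear :: "('a :: real_vector \<Rightarrow> real) \<Rightarrow> bool" where
  "sublinear q \<longleftrightarrow> (\<forall>x y. q (x + y) \<le> q x + q y) \<and> (\<forall>t\<ge>0. \<forall>x. q (t *\<^sub>R x) \<le> t * q x)"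

lemma sublinear_add: "sublinear q \<Longrightarrow> q (x + y) \<le> q x + q y"
  by (simp add: sublinear_def)

lemma sublinear_0: "sublinear q \<Longrightarrow> q 0 = 0"
  using sublinear_add[of q 0 0] by (auto simp: sublinear_def dest!: spec[of _ "0::real"])

lemma sublinear_scaleR:
  assumes "sublinear q" "t \<ge> 0"
  shows "q (t *\<^sub>R x) = t * q x"
proof (cases "t = 0")
  case False
  have "q (inverse t *\<^sub>R t *\<^sub>R x) \<le> inverse t * q (t *\<^sub>R x)"
    using assms False unfolding sublinear_def by (metis inverse_nonnegative_iff_nonnegative)
  then have "t * q x \<le> q (t *\<^sub>R x)"
    using False assms(2) by (simp add: field_simps)
  then show ?thesis using assms by (simp add: sublinear_def order_antisym)
qed (simp add: sublinear_0 assms)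

text \<open>
Lowering a sublinear functional as far as possible in the direction \<open>- x\<close>. A \<^emph>\<open>minimal\<close> sublinear
functional cannot be lowered, so it satisfies \<open>q (- x) \<le> - q x\<close> for all \<open>x\<close> and is linear; applied
to the norm, the same construction produces a functional attaining its norm at \<open>x\<close>.
\<close>

lemma sublinear_tilt:
  assumes q: "sublinear q"
  obtains p where "sublinear p" "p \<le> q" "p (- x) \<le> - q x"
proof -
  define p where "p y = (INF t\<in>{0..}. q (y + t *\<^sub>R x) - t * q x)" for y
  have below: "- q (- y) \<le> q (y + t *\<^sub>R x) - t * q x" if "t \<ge> 0" for t y
    using sublinear_add[OF q, of "y + t *\<^sub>R x" "- y"] sublinear_scaleR[OF q that, of x] by simp
  then have bdd: "bdd_below ((\<lambda>t. q (y + t *\<^sub>R x) - t * q x) ` {0..})" for y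
    unfolding bdd_below_def by (intro exI[of _ "- q (- y)"]) auto
  have p_le: "p y \<le> q (y + t *\<^sub>R x) - t * q x" if "t \<ge> 0" for t y
    unfolding p_def using that by (intro cINF_lower[OF bdd]) auto
  have p_ge: "c \<le> p y" if "\<And>t. t \<ge> 0 \<Longrightarrow> c \<le> q (y + t *\<^sub>R x) - t * q x" for c y
    unfolding p_def using that by (intro cINF_greatest) auto
  have "p (y + z) \<le> p y + p z" for y z
  proof -
    have "p (y + z) \<le> (q (y + t *\<^sub>R x) - t * q x) + (q (z + s *\<^sub>R x) - s * q x)"
      if "t \<ge> 0" "s \<ge> 0" for s t
      using p_le[of "t + s" "y + z"] sublinear_add[OF q, of "y + t *\<^sub>R x" "z + s *\<^sub>R x"] that
      by (simp add: algebra_simps)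
    then have "p (y + z) - (q (z + s *\<^sub>R x) - s * q x) \<le> p y" if "s \<ge> 0" for s
      using that by (intro p_ge) (simp add: algebra_simps)
    then have "p (y + z) - p y \<le> p z" by (intro p_ge) (simp add: algebra_simps)
    then show ?thesis by simp
  qed
  moreover have "p (s *\<^sub>R y) \<le> s * p y" if s: "s \<ge> 0" for s y
  proof (cases "s = 0")
    case True
    then show ?thesis using p_le[of 0 0] sublinear_0[OF q] by simp
  next
    case False
    have "p (s *\<^sub>R y) / s \<le> q (y + t *\<^sub>R x) - t * q x" if "t \<ge> 0" for t
      using p_le[of "s * t" "s *\<^sub>R y"] sublinear_scaleR[OF q s, of "y + t *\<^sub>R x"] that s False
      by (simp add: field_simps scaleR_add_right)
    then have "p (s *\<^sub>R y) / s \<le> p y" by (rule p_ge)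
    then show ?thesis using s False by (simp add: field_simps)
  qed
  ultimately have "sublinear p" by (simp add: sublinear_def)
  moreover have "p \<le> q" using p_le[of 0] by (simp add: le_fun_def)
  moreover have "p (- x) \<le> - q x" using p_le[of 1 "- x"] sublinear_0[OF q] by simp
  ultimately show ?thesis by (rule that)
qed

text \<open>
Zorn's lemma with pointwise infima of chains. They are finite because every sublinear \<open>a \<le> q\<close>
satisfies \<open>- q (- y) \<le> a y\<close>, and subadditive because two members of a chain have a common lower
bound in it.
\<close>

lemma minimal_sublinear_below:
  assumes q: "sublinear q"
  obtains m where "sublinear m" "m \<le> q" "\<And>p. sublinear p \<Longrightarrow> p \<le> m \<Longrightarrow> p = m"
proof -
  define A where "A = {p. sublinear p \<and> p \<le> q}"
  have "\<exists>m\<in>A. \<forall>a\<in>A. a \<le> m \<longrightarrow> a = m"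
  proof (rule predicate_Zorn)
    show "partial_order_on A (relation_of (\<lambda>m a. a \<le> m) A)"
      by (auto simp: partial_order_on_def preorder_on_def refl_on_def trans_def antisym_def
          relation_of_def)
    fix C assume "C \<in> Chains (relation_of (\<lambda>m a. a \<le> m) A)"
    then have C: "C \<subseteq> A" "\<And>a b. a \<in> C \<Longrightarrow> b \<in> C \<Longrightarrow> a \<le> b \<or> b \<le> a"
      by (auto simp: Chains_def relation_of_def)
    show "\<exists>u\<in>A. \<forall>a\<in>C. u \<le> a"
    proof (cases "C = {}")
      case True
      then show ?thesis using q by (auto simp: A_def)
    next
      case False
      define m where "m y = (INF a\<in>C. a y)" for y
      have sub: "sublinear a" "a y \<le> q y" if "a \<in> C" for a y
        using that C by (auto simp: A_def le_fun_def)
      have "- q (- y) \<le> a y" if "a \<in> C" for a y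
        using sub[OF that] sublinear_add[of a y "- y"] sublinear_0[of a] by (smt (verit) add.right_inverse)
      then have "bdd_below ((\<lambda>a. a y) ` C)" for y
        unfolding bdd_below_def by (intro exI[of _ "- q (- y)"]) auto
      then have m_le: "m y \<le> a y" if "a \<in> C" for a y
        unfolding m_def using that by (intro cINF_lower) auto
      have m_ge: "c \<le> m y" if "\<And>a. a \<in> C \<Longrightarrow> c \<le> a y" for c y
        unfolding m_def using that False by (intro cINF_greatest) auto
      have "m (y + z) \<le> m y + m z" for y z
      proof -
        have "m (y + z) \<le> a y + b z" if ab: "a \<in> C" "b \<in> C" for a b
        proof -
          obtain c where "c \<in> C" "c \<le> a" "c \<le> b" using C(2)[OF ab] ab by blast
          then show ?thesis
            using m_le[of c "y + z"] sublinear_add[OF sub(1), of c y z] by (smt (verit) le_funD)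
        qed
        then have "m (y + z) - b z \<le> m y" if "b \<in> C" for b
          using that by (intro m_ge) (simp add: algebra_simps)
        then have "m (y + z) - m y \<le> m z" by (intro m_ge) (simp add: algebra_simps)
        then show ?thesis by simp
      qed
      moreover have "m (s *\<^sub>R y) \<le> s * m y" if s: "s \<ge> 0" for s y
      proof (cases "s = 0")
        case True
        then show ?thesis using False m_le[of _ 0] sublinear_0[OF sub(1)] by force
      next
        case ne: False
        have "m (s *\<^sub>R y) / s \<le> m y"
          using m_le[of _ "s *\<^sub>R y"] sublinear_scaleR[OF sub(1) s] s ne
          by (intro m_ge) (force simp: field_simps)
        then show ?thesis using s ne by (simp add: field_simps)
      qed
      ultimately have "sublinear m" by (simp add: sublinear_def)
      moreover have "m \<le> q" using False m_le sub(2) by (meson all_not_in_conv le_funI order_trans)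
      ultimately show ?thesis using m_le by (auto simp: A_def le_fun_def intro!: bexI[of _ m])
    qed
  qed
  then obtain m where "m \<in> A" "\<And>a. a \<in> A \<Longrightarrow> a \<le> m \<Longrightarrow> a = m" by blast
  then show ?thesis using that[of m] by (auto simp: A_def intro: order_trans)
qed

text \<open>
Tilt the norm so that its value at \<open>- x\<close> drops to \<open>- norm x\<close>, and take a minimal sublinear functional
below the result. It is linear, and \<open>f (- x) \<le> - norm x\<close> forces \<open>f x = norm x\<close>.
\<close>

theorem real_Hahn_Banach_norming:
  fixes x :: "'a :: real_normed_vector"
  obtains f where "linear f" "\<And>y. f y \<le> norm y" "f x = norm x"
proof -
  have "sublinear (norm :: 'a \<Rightarrow> real)" by (simp add: sublinear_def norm_triangle_ineq)
  then obtain p where p: "sublinear p" "p \<le> norm" "p (- x) \<le> - norm x"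
    by (rule sublinear_tilt)
  obtain m where m: "sublinear m" "m \<le> p" "\<And>p. sublinear p \<Longrightarrow> p \<le> m \<Longrightarrow> p = m"
    using minimal_sublinear_below[OF p(1)] by blast
  have neg: "m (- y) = - m y" for y
  proof -
    obtain r where "sublinear r" "r \<le> m" "r (- y) \<le> - m y" by (rule sublinear_tilt[OF m(1)])
    then have "m (- y) \<le> - m y" using m(3) by blast
    then show ?thesis using sublinear_add[OF m(1), of y "- y"] sublinear_0[OF m(1)] by simp
  qed
  have "linear m"
  proof (rule linearI)
    show "m (y + z) = m y + m z" for y z
      using sublinear_add[OF m(1), of y z] sublinear_add[OF m(1), of "- y" "- z"] neg[of "y + z"] neg
      by simp
    show "m (c *\<^sub>R y) = c *\<^sub>R m y" for c y
    proof (cases "c \<ge> 0")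
      case False
      then show ?thesis using sublinear_scaleR[OF m(1), of "- c" y] neg[of "c *\<^sub>R y"] by simp
    qed (simp add: sublinear_scaleR[OF m(1)])
  qed
  moreover have "m y \<le> norm y" for y using m(2) p(2) by (meson le_funD order_trans)
  moreover have "m x = norm x"
    using m(2) p(3) neg[of x] calculation(2)[of x] by (smt (verit) le_funD)
  ultimately show ?thesis by (rule that)
qed

section \<open>Dual balls and their extreme points\<close>

lemma dual_spaceD:
  assumes "f \<in> dual_space X"
  shows "x \<in> X \<Longrightarrow> y \<in> X \<Longrightarrow> f (x + y) = f x + f y"
    and "x \<in> X \<Longrightarrow> f (c *\<^sub>C x) = c * f x"
    and "x \<notin> X \<Longrightarrow> f x = 0"
  using assms by (auto simp: dual_space_def)

lemma dual_spaceI: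
  assumes "\<And>x y. x \<in> X \<Longrightarrow> y \<in> X \<Longrightarrow> f (x + y) = f x + f y"
    and "\<And>c x. x \<in> X \<Longrightarrow> f (c *\<^sub>C x) = c * f x"
    and "\<And>x. x \<in> X \<Longrightarrow> cmod (f x) \<le> K * norm x"
    and "\<And>x. x \<notin> X \<Longrightarrow> f x = 0"
  shows "f \<in> dual_space X"
  unfolding dual_space_def using assms by blast

lemma dual_space_add:
  assumes "f \<in> dual_space X" "g \<in> dual_space X"
  shows "f + g \<in> dual_space X"
proof -
  obtain K L where KL: "\<forall>x\<in>X. cmod (f x) \<le> K * norm x" "\<forall>x\<in>X. cmod (g x) \<le> L * norm x"
    using assms by (auto simp: dual_space_def)
  show ?thesis
  proof (rule dual_spaceI)
    show "cmod ((f + g) x) \<le> (K + L) * norm x" if "x \<in> X" for x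
      using KL that by (auto simp: distrib_right intro!: norm_triangle_le add_mono)
  qed (simp_all add: dual_spaceD[OF assms(1)] dual_spaceD[OF assms(2)] algebra_simps)
qed

lemma dual_space_scaleC:
  assumes "f \<in> dual_space X"
  shows "c *\<^sub>C f \<in> dual_space X"
proof -
  obtain K where K: "\<forall>x\<in>X. cmod (f x) \<le> K * norm x"
    using assms by (auto simp: dual_space_def)
  show ?thesis
  proof (rule dual_spaceI)
    show "cmod ((c *\<^sub>C f) x) \<le> (cmod c * K) * norm x" if "x \<in> X" for x
      using K that
      by (auto simp: scaleC_fun_def scaleC_complex_def norm_mult mult.assoc intro!: mult_left_mono)
  qed (simp_all add: scaleC_fun_def scaleC_complex_def dual_spaceD[OF assms] algebra_simps)
qed

lemma uminus_eq_scaleC: "- x = (- 1) *\<^sub>C (x :: 'a :: complex_vector)"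
  using scaleR_scaleC[of "- 1" x] by simp

lemma dual_space_diff: "f \<in> dual_space X \<Longrightarrow> g \<in> dual_space X \<Longrightarrow> f - g \<in> dual_space X"
  using dual_space_add[of f X "- g"] dual_space_scaleC[of g X "- 1"]
  by (simp add: uminus_eq_scaleC[symmetric])

lemma dual_norm_upper:
  assumes "f \<in> dual_space X" "x \<in> X" "norm x \<le> 1"
  shows "cmod (f x) \<le> dual_norm X f"
proof -
  obtain K where K: "\<forall>x\<in>X. cmod (f x) \<le> K * norm x"
    using assms by (auto simp: dual_space_def)
  have "cmod (f y) \<le> \<bar>K\<bar>" if "y \<in> X \<inter> cball 0 1" for y
  proof -
    have "cmod (f y) \<le> \<bar>K\<bar> * norm y"
      using K that by (meson IntD1 abs_ge_self mult_right_mono norm_ge_zero order_trans)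
    also have "\<dots> \<le> \<bar>K\<bar> * 1" using that by (intro mult_left_mono) auto
    finally show ?thesis by simp
  qed
  then have "bdd_above ((\<lambda>x. cmod (f x)) ` (X \<inter> cball 0 1))" by (rule bdd_aboveI2)
  then show ?thesis unfolding dual_norm_def using assms by (intro cSUP_upper) auto
qed

lemma dual_norm_least:
  assumes "0 \<in> X" "\<And>x. x \<in> X \<Longrightarrow> norm x \<le> 1 \<Longrightarrow> cmod (f x) \<le> K"
  shows "dual_norm X f \<le> K"
  unfolding dual_norm_def using assms by (intro cSUP_least) auto

lemma dual_norm_nonneg: "f \<in> dual_space X \<Longrightarrow> 0 \<in> X \<Longrightarrow> 0 \<le> dual_norm X f"
  using dual_norm_upper[of f X 0] norm_ge_zero[of "f 0"] by (simp del: norm_ge_zero)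

lemma dual_norm_bound:
  assumes X: "csubspace X" and f: "f \<in> dual_space X" and x: "x \<in> X"
  shows "cmod (f x) \<le> dual_norm X f * norm x"
proof (cases "x = 0")
  case True
  then show ?thesis using dual_spaceD(2)[OF f x, of 0] by simp
next
  case False
  define c where "c = complex_of_real (inverse (norm x))"
  have "c *\<^sub>C x \<in> X" using X x by (rule complex_vector.subspace_scale)
  moreover have "norm (c *\<^sub>C x) = 1" using False by (simp add: norm_scaleC c_def norm_inverse)
  ultimately have "cmod (c * f x) \<le> dual_norm X f"
    using dual_norm_upper[OF f, of "c *\<^sub>C x"] dual_spaceD(2)[OF f x] by simp
  then show ?thesis using False by (simp add: c_def norm_mult norm_inverse norm_divide field_simps)
qed

lemma dual_norm_triangle:
  assumes "f \<in> dual_space X" "g \<in> dual_space X" "0 \<in> X"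
  shows "dual_norm X (f + g) \<le> dual_norm X f + dual_norm X g"
  using assms dual_norm_upper
  by (intro dual_norm_least) (auto intro!: norm_triangle_le add_mono)

lemma dual_norm_scaleC:
  assumes "f \<in> dual_space X" "0 \<in> X"
  shows "dual_norm X (c *\<^sub>C f) = cmod c * dual_norm X f"
proof -
  have le: "dual_norm X (c *\<^sub>C f) \<le> cmod c * dual_norm X f" if "f \<in> dual_space X" for c f
    using that assms(2) dual_norm_upper[of f X]
    by (intro dual_norm_least)
      (auto simp: scaleC_fun_def scaleC_complex_def norm_mult intro!: mult_left_mono)
  show ?thesis
  proof (cases "c = 0")
    case True
    then show ?thesis
      using le[OF assms(1), of 0] dual_norm_nonneg[OF dual_space_scaleC[OF assms(1)] assms(2), of 0]
      by simp
  next
    case False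
    have "dual_norm X f \<le> inverse (cmod c) * dual_norm X (c *\<^sub>C f)"
      using le[OF dual_space_scaleC[OF assms(1)], of "inverse c" c] False
      by (simp add: scaleC_scaleC norm_inverse)
    then show ?thesis using le[OF assms(1), of c] False by (simp add: field_simps)
  qed
qed

lemma dual_norm_minus_commute:
  assumes "f \<in> dual_space X" "g \<in> dual_space X" "0 \<in> X"
  shows "dual_norm X (f - g) = dual_norm X (g - f)"
  using dual_norm_scaleC[OF dual_space_diff[OF assms(1,2)] assms(3), of "- 1"]
  by (simp add: uminus_eq_scaleC[symmetric])

lemma dual_norm_eq_0:
  assumes "csubspace X" "f \<in> dual_space X" "dual_norm X f \<le> 0"
  shows "f = 0"
proof
  fix x show "f x = 0 x"
  proof (cases "x \<in> X")
    case True
    have "dual_norm X f * norm x \<le> 0" using assms(3) by (simp add: mult_nonpos_nonneg)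
    then show ?thesis using dual_norm_bound[OF assms(1,2) True]
      by (metis norm_le_zero_iff order_trans zero_fun_apply)
  qed (simp add: dual_spaceD(3)[OF assms(2)])
qed

text \<open>
The coordinatewise form of membership in the dual ball. The bound \<open>0\<close> off \<open>X\<close> encodes that functionals
are extended by zero.
\<close>

lemma dual_ball_iff:
  assumes "csubspace X"
  shows "f \<in> dual_ball X \<longleftrightarrow>
    (\<forall>x. cmod (f x) \<le> (if x \<in> X then norm x else 0)) \<and>
    (\<forall>x\<in>X. \<forall>y\<in>X. f (x + y) = f x + f y) \<and> (\<forall>c. \<forall>x\<in>X. f (c *\<^sub>C x) = c * f x)"
    (is "_ \<longleftrightarrow> ?R")
proof
  assume f: "f \<in> dual_ball X"
  then have "f \<in> dual_space X" "dual_norm X f \<le> 1" by (auto simp: dual_ball_def)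
  moreover have "cmod (f x) \<le> norm x" if "x \<in> X" for x
    using dual_norm_bound[OF assms calculation(1) that]
      mult_right_mono[OF calculation(2), of "norm x"] by simp
  ultimately show ?R using dual_spaceD by auto
next
  assume R: ?R
  then have bound: "cmod (f x) \<le> (if x \<in> X then norm x else 0)" for x by blast
  have le: "cmod (f x) \<le> norm x" if "x \<in> X" for x using bound[of x] that by simp
  have "f x = 0" if "x \<notin> X" for x using bound[of x] that by simp
  then have "f \<in> dual_space X"
    using R le by (intro dual_spaceI[of X f 1]) auto
  moreover have "dual_norm X f \<le> 1"
    using le complex_vector.subspace_0[OF assms] by (intro dual_norm_least) (auto intro: order_trans)
  ultimately show "f \<in> dual_ball X" by (simp add: dual_ball_def)
qed

lemma dual_ball_bound:
  assumes "csubspace X" "f \<in> dual_ball X" "x \<in> X"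
  shows "cmod (f x) \<le> norm x"
  using spec[OF conjunct1[OF assms(2)[unfolded dual_ball_iff[OF assms(1)]]], of x] assms(3) by simp

text \<open>
The Banach-Alaoglu theorem: the dual ball is cut out of a product of discs, compact by Tychonoff's
theorem, by the closed conditions of linearity. Off \<open>X\<close> the disc is the point \<open>0\<close>.
\<close>

theorem compact_dual_ball:
  assumes "csubspace X"
  shows "compact (dual_ball X)"
proof -
  let ?P = "\<Pi>\<^sub>E x\<in>UNIV. cball (0 :: complex) (if x \<in> X then norm x else 0)"
  have "compactin (product_topology (\<lambda>_. euclidean) UNIV) ?P"
    by (subst compactin_PiE) auto
  then have P: "compact ?P" by (simp add: euclidean_product_topology)
  have c: "continuous_on UNIV (\<lambda>f :: 'a \<Rightarrow> complex. f x)" for x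
    by (rule continuous_on_product_coordinates)
  have "closed {f :: 'a \<Rightarrow> complex. f (x + y) = f x + f y}" for x y
    by (intro closed_Collect_eq continuous_on_add c)
  moreover have "closed {f :: 'a \<Rightarrow> complex. f (k *\<^sub>C x) = k * f x}" for x k
    by (intro closed_Collect_eq continuous_on_mult continuous_on_const c)
  ultimately have "closed ((\<Inter>x\<in>X. \<Inter>y\<in>X. {f :: 'a \<Rightarrow> complex. f (x + y) = f x + f y}) \<inter>
      (\<Inter>k. \<Inter>x\<in>X. {f. f (k *\<^sub>C x) = k * f x}))" (is "closed ?C")
    by (intro closed_Int closed_INT ballI) auto
  moreover have "dual_ball X = ?P \<inter> ?C"
    using dual_ball_iff[OF assms] by (auto simp: PiE_iff dist_norm norm_minus_commute)
  ultimately show ?thesis using P by (simp add: compact_Int_closed)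
qed

lemma convex_dual_ball:
  assumes "csubspace X"
  shows "convex (dual_ball X)"
proof (rule convexI)
  fix f g :: "'a \<Rightarrow> complex" and u v :: real
  assume fg: "f \<in> dual_ball X" "g \<in> dual_ball X" and uv: "0 \<le> u" "0 \<le> v" "u + v = 1"
  have 0: "0 \<in> X" using assms by (rule complex_vector.subspace_0)
  have "dual_norm X (complex_of_real u *\<^sub>C f + complex_of_real v *\<^sub>C g) \<le> u * dual_norm X f + v * dual_norm X g"
    using dual_norm_triangle[OF dual_space_scaleC dual_space_scaleC 0, of f g u v] fg uv 0
    by (simp add: dual_ball_def dual_norm_scaleC)
  also have "\<dots> \<le> u * 1 + v * 1" using fg uv by (intro add_mono mult_left_mono) (auto simp: dual_ball_def)
  finally show "u *\<^sub>R f + v *\<^sub>R g \<in> dual_ball X"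
    using fg uv by (simp add: dual_ball_def scaleR_scaleC dual_space_add dual_space_scaleC)
qed

theorem Hahn_Banach_norming:
  assumes X: "csubspace X" and x: "x \<in> X"
  obtains f where "f \<in> dual_ball X" "f x = complex_of_real (norm x)"
proof -
  obtain m :: "'a \<Rightarrow> real" where m: "linear m" "\<And>y. m y \<le> norm y" "m x = norm x"
    using real_Hahn_Banach_norming[of x] by blast
  \<comment> \<open>The complex functional whose real part is \<open>m\<close>.\<close>
  define F where "F y = Complex (m y) (- m (\<i> *\<^sub>C y))" for y
  have F_add: "F (y + z) = F y + F z" for y z
    using m(1) by (simp add: F_def complex_eq_iff scaleC_add_right linear_add)
  have m_C: "m (c *\<^sub>C y) = Re c * m y + Im c * m (\<i> *\<^sub>C y)" for c y
  proof -
    have "complex_of_real (Re c) + complex_of_real (Im c) * \<i> = c" by (simp add: complex_eq_iff)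
    then have "c *\<^sub>C y = (complex_of_real (Re c) + complex_of_real (Im c) * \<i>) *\<^sub>C y"
      by (rule arg_cong[OF sym])
    also have "\<dots> = Re c *\<^sub>R y + Im c *\<^sub>R (\<i> *\<^sub>C y)"
      by (simp add: scaleC_add_left scaleR_scaleC scaleC_scaleC)
    finally show ?thesis using m(1) by (simp add: linear_add linear_scale)
  qed
  have F_scale: "F (c *\<^sub>C y) = c * F y" for c y
    using m_C[of c y] m_C[of "\<i> * c" y] by (simp add: F_def complex_eq_iff scaleC_scaleC)
  have F_le: "cmod (F y) \<le> norm y" for y
  proof (cases "F y = 0")
    case False
    \<comment> \<open>Rotate \<open>y\<close> so that \<open>F\<close> becomes real and positive there.\<close>
    define c where "c = cnj (F y) / complex_of_real (cmod (F y))"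
    have "complex_of_real (cmod (F y)) = c * F y"
      using False complex_norm_square[of "F y"] by (simp add: c_def field_simps power2_eq_square)
    then have "cmod (F y) = Re (F (c *\<^sub>C y))" unfolding F_scale by (metis Re_complex_of_real)
    also have "\<dots> \<le> norm (c *\<^sub>C y)" using m(2) by (simp add: F_def)
    also have "\<dots> = norm y" using False by (simp add: norm_scaleC c_def norm_divide)
    finally show ?thesis .
  qed simp
  define f where "f y = (if y \<in> X then F y else 0)" for y
  have "f \<in> dual_ball X"
    unfolding dual_ball_iff[OF X] using X F_add F_scale F_le
    by (auto simp: f_def complex_vector.subspace_add complex_vector.subspace_scale)
  moreover have "f x = complex_of_real (norm x)"
  proof -
    have "(norm x)\<^sup>2 + (Im (F x))\<^sup>2 \<le> (norm x)\<^sup>2"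
      using power_mono[OF F_le[of x], of 2] m(3) by (simp add: cmod_power2 F_def)
    then have "Im (F x) = 0" by simp
    then show ?thesis using x m(3) by (simp add: f_def complex_eq_iff F_def)
  qed
  ultimately show ?thesis by (rule that)
qed


lemma face_of_maximum:
  fixes h :: "'b :: real_vector \<Rightarrow> real"
  assumes h: "linear h" and F: "convex F" "\<And>g. g \<in> F \<Longrightarrow> h g \<le> M"
  shows "{g \<in> F. h g = M} face_of F"
  unfolding face_of_def
proof (intro conjI ballI impI)
  have "{g \<in> F. h g = M} = F \<inter> h -` {M}" by auto
  then show "convex {g \<in> F. h g = M}"
    using F(1) convex_linear_vimage[OF h, of "{M}"] by (simp add: convex_Int)
  fix a b g assume ab: "a \<in> F" "b \<in> F" and g: "g \<in> {g \<in> F. h g = M}" "g \<in> open_segment a b"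
  then obtain u where u: "0 < u" "u < 1" "g = (1 - u) *\<^sub>R a + u *\<^sub>R b" by (auto simp: in_segment)
  then have M: "M = (1 - u) * h a + u * h b" using g(1) h by (simp add: linear_add linear_scale)
  have "(1 - u) * (M - h a) + u * (M - h b) = 0" using M by (simp add: algebra_simps)
  moreover have "0 \<le> (1 - u) * (M - h a)" "0 \<le> u * (M - h b)" using u F(2) ab by simp_all
  ultimately have "(1 - u) * (M - h a) = 0 \<and> u * (M - h b) = 0" by linarith
  then show "a \<in> {g \<in> F. h g = M}" "b \<in> {g \<in> F. h g = M}" using u ab by auto
qed auto

text \<open>
Zorn's lemma: compactness keeps the intersection of a chain nonempty. It is used with \<open>P\<close> saying that
a set is a face of the dual ball.
\<close>

lemma minimal_closed_subset:
  fixes B C :: "'b :: t2_space set"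
  assumes B: "compact B" and C: "closed C" "C \<noteq> {}" "P C" "C \<subseteq> B"
    and inter: "\<And>\<F>. \<F> \<noteq> {} \<Longrightarrow> (\<And>F. F \<in> \<F> \<Longrightarrow> P F) \<Longrightarrow> P (\<Inter>\<F>)"
  obtains F where "closed F" "F \<noteq> {}" "P F" "F \<subseteq> C"
    "\<And>G. closed G \<Longrightarrow> G \<noteq> {} \<Longrightarrow> P G \<Longrightarrow> G \<subseteq> F \<Longrightarrow> G = F"
proof -
  define A where "A = {F. closed F \<and> F \<noteq> {} \<and> P F \<and> F \<subseteq> C}"
  have "\<exists>F\<in>A. \<forall>G\<in>A. G \<subseteq> F \<longrightarrow> G = F"
  proof (rule predicate_Zorn)
    show "partial_order_on A (relation_of (\<lambda>F G. G \<subseteq> F) A)"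
      by (auto simp: partial_order_on_def preorder_on_def refl_on_def trans_def antisym_def
          relation_of_def)
    fix \<F> assume "\<F> \<in> Chains (relation_of (\<lambda>F G. G \<subseteq> F) A)"
    then have \<F>: "\<F> \<subseteq> A" "\<And>F G. F \<in> \<F> \<Longrightarrow> G \<in> \<F> \<Longrightarrow> F \<subseteq> G \<or> G \<subseteq> F"
      by (auto simp: Chains_def relation_of_def)
    show "\<exists>U\<in>A. \<forall>F\<in>\<F>. U \<subseteq> F"
    proof (cases "\<F> = {}")
      case True
      then show ?thesis using C by (auto simp: A_def)
    next
      case False
      have "B \<inter> \<Inter>\<F> \<noteq> {}"
      proof (rule compact_imp_fip[OF B])
        fix \<G> assume \<G>: "finite \<G>" "\<G> \<subseteq> \<F>"
        show "B \<inter> \<Inter>\<G> \<noteq> {}"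
        proof (cases "\<G> = {}")
          case True
          then show ?thesis using C by auto
        next
          case False
          have "subset.chain A \<G>" using \<F> \<G> by (auto simp: subset.chain_def)
          then have "\<Inter>\<G> \<in> A" using Inter_in_chain[OF \<G>(1) False] \<F> \<G> by blast
          then show ?thesis using C(4) by (auto simp: A_def)
        qed
      qed (use \<F> in \<open>auto simp: A_def\<close>)
      moreover have "closed (\<Inter>\<F>)" using \<F> by (intro closed_Inter) (auto simp: A_def)
      moreover have "P (\<Inter>\<F>)" using \<F> by (intro inter False) (auto simp: A_def)
      moreover have "\<Inter>\<F> \<subseteq> C" using False \<F>(1) by (auto simp: A_def)
      ultimately have "\<Inter>\<F> \<in> A" by (auto simp: A_def)
      then show ?thesis by blast
    qed
  qed
  then obtain F where F: "F \<in> A" "\<And>G. G \<in> A \<Longrightarrow> G \<subseteq> F \<Longrightarrow> G = F" by blast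
  show ?thesis
  proof (rule that[of F])
    show "G = F" if "closed G" "G \<noteq> {}" "P G" "G \<subseteq> F" for G
      using F that by (auto simp: A_def)
  qed (use F(1) in \<open>auto simp: A_def\<close>)
qed

text \<open>
Inside the face of functionals that norm \<open>x\<close>, a minimal closed face of the dual ball is a single
point: on it every functional \<open>g \<mapsto> Re (c * g y)\<close> is constant, since the set where it attains its
maximum is again a closed face. A one-point face is an extreme point.
\<close>

theorem norming_extreme_point:
  assumes X: "csubspace X" and x: "x \<in> X"
  obtains f where "f \<in> dual_extreme_points X" "cmod (f x) = norm x"
proof -
  define B where "B = dual_ball X"
  have B: "compact B" "convex B" using compact_dual_ball[OF X] convex_dual_ball[OF X] by (simp_all add: B_def)
  define h where "h c y g = Re (c * g y)" for c y and g :: "'a \<Rightarrow> complex"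
  have lin: "linear (h c y)" for c y
    by (intro linearI) (simp_all add: h_def scaleR_fun_def algebra_simps)
  have cont: "continuous_on S (h c y)" for S c y
    unfolding h_def
    by (intro continuous_intros continuous_on_subset[OF continuous_on_product_coordinates]) auto
  define C where "C = {f \<in> B. h 1 x f = norm x}"
  have le: "h 1 x f \<le> norm x" if "f \<in> B" for f
  proof -
    have "cmod (f x) \<le> norm x" using that unfolding B_def by (rule dual_ball_bound[OF X _ x])
    then show ?thesis using complex_Re_le_cmod[of "f x"] by (simp add: h_def)
  qed
  have C_face: "C face_of B" unfolding C_def using lin B(2) le by (rule face_of_maximum)
  have C_closed: "closed C"
  proof -
    have "closed {f. h 1 x f = norm x}" by (intro closed_Collect_eq cont continuous_on_const)
    moreover have "C = B \<inter> {f. h 1 x f = norm x}" by (auto simp: C_def)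
    ultimately show ?thesis using B(1) by (simp add: compact_imp_closed closed_Int)
  qed
  have C_ne: "C \<noteq> {}"
  proof -
    obtain f where "f \<in> dual_ball X" "f x = complex_of_real (norm x)"
      using Hahn_Banach_norming[OF X x] by blast
    then have "f \<in> C" by (simp add: C_def h_def B_def)
    then show ?thesis by blast
  qed
  obtain F where F: "closed F" "F \<noteq> {}" "F face_of B" "F \<subseteq> C"
      and min: "\<And>G. closed G \<Longrightarrow> G \<noteq> {} \<Longrightarrow> G face_of B \<Longrightarrow> G \<subseteq> F \<Longrightarrow> G = F"
  proof (rule minimal_closed_subset[OF B(1) C_closed C_ne, of "\<lambda>F. F face_of B"])
    show "C \<subseteq> B" by (auto simp: C_def)
    show "\<Inter>\<F> face_of B" if "\<F> \<noteq> {}" "\<And>F. F \<in> \<F> \<Longrightarrow> F face_of B" for \<F>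
      using that by (rule face_of_Inter)
  qed (rule C_face, blast)
  have FB: "F \<subseteq> B" using F(3) by (rule face_of_imp_subset)
  have compF: "compact F" using compact_Int_closed[OF B(1) F(1)] FB by (simp add: Int_absorb1)
  obtain f where f: "f \<in> F" using F(2) by blast
  have const: "h c y g = h c y f" if g: "g \<in> F" for c y g
  proof -
    obtain m where m: "m \<in> F" "\<And>k. k \<in> F \<Longrightarrow> h c y k \<le> h c y m"
      using continuous_attains_sup[OF compF F(2) cont[of F c y]] by blast
    define G where "G = {k \<in> F. h c y k = h c y m}"
    have "G face_of F"
      unfolding G_def using lin face_of_imp_convex[OF F(3)] m(2) by (rule face_of_maximum)
    then have "G face_of B" using F(3) by (rule face_of_trans)
    moreover have "closed G"
    proof -
      have "closed {k. h c y k = h c y m}" by (intro closed_Collect_eq cont continuous_on_const)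
      moreover have "G = F \<inter> {k. h c y k = h c y m}" by (auto simp: G_def)
      ultimately show ?thesis using F(1) by (simp add: closed_Int)
    qed
    ultimately have "G = F" using m(1) by (intro min) (auto simp: G_def)
    then have "g \<in> G" "f \<in> G" using f g by auto
    then show ?thesis by (simp add: G_def)
  qed
  \<comment> \<open>The constants \<open>1\<close> and \<open>- \<i>\<close> recover the real and imaginary parts.\<close>
  have "g = f" if "g \<in> F" for g
  proof
    fix y show "g y = f y"
      using const[OF that, of 1 y] const[OF that, of "- \<i>" y] by (simp add: h_def complex_eq_iff)
  qed
  then have "F = {f}" using f by blast
  then have "f extreme_point_of B" using F(3) by (simp add: face_of_singleton)
  moreover have "cmod (f x) = norm x"
  proof -
    have "Re (f x) = norm x" using f F(4) by (auto simp: C_def h_def)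
    moreover have "cmod (f x) \<le> norm x"
      using f FB unfolding B_def by (intro dual_ball_bound[OF X _ x]) blast
    ultimately show ?thesis using complex_Re_le_cmod[of "f x"] by simp
  qed
  ultimately show ?thesis using that by (simp add: dual_extreme_points_def B_def)
qed

section \<open>Separated sets of functionals of norm one\<close>

lemma dual_norm_zero:
  assumes "0 \<in> X"
  shows "dual_norm X 0 = 0"
proof -
  have "0 \<in> dual_space X" by (rule dual_spaceI[where K = 0]) auto
  then show ?thesis using dual_norm_scaleC[of 0 X 0] assms by simp
qed

lemma dual_norm_lower_semicontinuous:
  assumes X: "csubspace X" and r: "r < dual_norm X (f - g)"
  obtains U V where "open U" "open V" "f \<in> U" "g \<in> V"
    "\<forall>f'\<in>dual_space X \<inter> closure U. \<forall>g'\<in>dual_space X \<inter> closure V. r \<le> dual_norm X (f' - g')"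
proof -
  have "\<not> (\<forall>x\<in>X. norm x \<le> 1 \<longrightarrow> cmod ((f - g) x) \<le> r)"
    using dual_norm_least[OF complex_vector.subspace_0[OF X], of "f - g" r] r by auto
  then obtain x where x: "x \<in> X" "norm x \<le> 1" "r < cmod (f x - g x)"
    by (auto simp: not_le)
  define \<eta> where "\<eta> = (cmod (f x - g x) - r) / 2"
  have \<eta>: "\<eta> > 0" using x by (simp add: \<eta>_def)
  have closed: "closed {h. h x \<in> cball c \<eta>}" for c
    using closed_vimage[OF closed_cball continuous_on_product_coordinates]
    by (simp add: vimage_def)
  have clos: "closure {h. h x \<in> ball c \<eta>} \<subseteq> {h. h x \<in> cball c \<eta>}" for c
    using closed by (intro closure_minimal) auto
  show ?thesis
  proof (rule that[of "{h. h x \<in> ball (f x) \<eta>}" "{h. h x \<in> ball (g x) \<eta>}"])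
    show "open {h. h x \<in> ball (f x) \<eta>}" "open {h. h x \<in> ball (g x) \<eta>}"
      by (intro open_coordinate_vimage open_ball)+
    show "\<forall>f'\<in>dual_space X \<inter> closure {h. h x \<in> ball (f x) \<eta>}.
        \<forall>g'\<in>dual_space X \<inter> closure {h. h x \<in> ball (g x) \<eta>}. r \<le> dual_norm X (f' - g')"
    proof (intro ballI, elim IntE)
      fix f' g' assume d: "f' \<in> dual_space X" "g' \<in> dual_space X"
        and "f' \<in> closure {h. h x \<in> ball (f x) \<eta>}" "g' \<in> closure {h. h x \<in> ball (g x) \<eta>}"
      then have "cmod (f x - f' x) \<le> \<eta>" "cmod (g x - g' x) \<le> \<eta>"
        using clos[of "f x"] clos[of "g x"] by (auto simp: dist_norm)
      moreover have "cmod (f x - g x) \<le> cmod (f x - f' x) + cmod (f' x - g' x) + cmod (g x - g' x)"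
        using norm_triangle_ineq[of "f x - f' x" "f' x - g x"] norm_triangle_ineq[of "f' x - g' x" "g' x - g x"]
        by (simp add: norm_minus_commute)
      moreover have "cmod (f x - g x) = r + 2 * \<eta>" by (simp add: \<eta>_def field_simps)
      ultimately have "r \<le> cmod ((f' - g') x)" by simp
      also have "\<dots> \<le> dual_norm X (f' - g')"
        using d x by (intro dual_norm_upper dual_space_diff)
      finally show "r \<le> dual_norm X (f' - g')" .
    qed
  qed (use \<eta> in auto)
qed

text \<open>
An infinite separated subset of \<open>K\<close> would give an injective net of separated functionals in \<open>K\<close> with
limit in \<open>K\<close>. The limit has norm one, whereas the net condition bounds its norm by \<open>1 - \<epsilon> / 2\<close>. The
set \<open>F\<close> covers both net conditions: all functionals, or the norm-attaining ones.
\<close>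

theorem finite_separated_subset_of_sphere:
  assumes X: "csubspace X"
    and cond: "separated_nets_condition TYPE('a \<Rightarrow> complex) (X :: 'a :: complex_normed_vector set) F"
    and K: "compact K" "K \<subseteq> dual_ball X \<inter> F" "\<And>f. f \<in> K \<Longrightarrow> dual_norm X f = 1"
    and S: "S \<subseteq> K" and r: "r > 0"
    and sep: "\<And>f g. f \<in> S \<Longrightarrow> g \<in> S \<Longrightarrow> f \<noteq> g \<Longrightarrow> r \<le> dual_norm X (f - g)"
  shows "finite S"
proof (rule ccontr)
  assume inf: "infinite S"
  have 0: "0 \<in> X" using X by (rule complex_vector.subspace_0)
  have dual: "f \<in> dual_space X" if "f \<in> K" for f using that K(2) by (auto simp: dual_ball_def)
  obtain t R p where t: "t > 0" and R: "R \<subseteq> K" "p \<in> K"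
    and t_sep: "\<And>f g. f \<in> R \<Longrightarrow> g \<in> R \<Longrightarrow> f \<noteq> g \<Longrightarrow> t \<le> dual_norm X (f - g)"
    and net: "limit_of_injective_net R p"
  proof (rule compact_separated_injective_net[OF K(1) S inf r, of "\<lambda>f g. dual_norm X (f - g)"])
    show "\<exists>U V. open U \<and> open V \<and> u \<in> U \<and> v \<in> V \<and>
        (\<forall>u'\<in>K \<inter> closure U. \<forall>v'\<in>K \<inter> closure V. s \<le> dual_norm X (u' - v'))"
      if uv: "u \<in> K" "v \<in> K" "s < dual_norm X (u - v)" for u v s
    proof -
      obtain U V where UV: "open U" "open V" "u \<in> U" "v \<in> V"
        "\<forall>f'\<in>dual_space X \<inter> closure U. \<forall>g'\<in>dual_space X \<inter> closure V. s \<le> dual_norm X (f' - g')"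
        by (rule dual_norm_lower_semicontinuous[OF X uv(3)])
      show ?thesis
        by (intro exI[of _ U] exI[of _ V] conjI UV(1-4)) (use UV(5) dual in auto)
    qed
    show "u = v" if uv: "u \<in> K" "v \<in> K" "dual_norm X (u - v) \<le> 0" for u v
      using dual_norm_eq_0[OF X dual_space_diff[OF dual[OF uv(1)] dual[OF uv(2)]] uv(3)] by simp
  qed (use sep dual 0 in \<open>auto simp: dual_norm_zero intro: dual_norm_minus_commute\<close>)
  then obtain I :: "('a \<Rightarrow> complex) set set" and le \<phi> where net:
      "directed_set I le" "\<not> has_greatest I le" "inj_on \<phi> I" "\<phi> ` I \<subseteq> R" "(\<phi> \<longlongrightarrow> p) (net_filter I le)"
    unfolding limit_of_injective_net_def by blast
  \<comment> \<open>The net condition is stated for \<open>\<epsilon> < 2\<close> only; a smaller \<open>\<epsilon>\<close> is harmless.\<close>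
  define \<epsilon> where "\<epsilon> = min t 1"
  have \<epsilon>: "0 < \<epsilon>" "\<epsilon> < 2" "\<epsilon> \<le> t" using t by (auto simp: \<epsilon>_def)
  have mem: "\<forall>i\<in>I. \<phi> i \<in> dual_ball X \<inter> F" using net(4) R K(2) by blast
  have lim: "limitin (weak_star X) \<phi> p (net_filter I le)"
  proof -
    obtain i where "i \<in> I" using net(1) by (auto simp: directed_set_def)
    then have "\<forall>\<^sub>F i in net_filter I le. \<phi> i \<in> dual_space X"
      using mem by (auto simp: eventually_net_filter[OF net(1)] dual_ball_def intro!: bexI[of _ i])
    then show ?thesis
      using net(5) dual[OF R(2)] by (simp add: weak_star_def limitin_subtopology)
  qed
  have "\<forall>i\<in>I. \<forall>j\<in>I. i \<noteq> j \<longrightarrow> \<epsilon> \<le> dual_norm X (\<phi> i - \<phi> j)"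
  proof (intro ballI impI)
    fix i j assume ij: "i \<in> I" "j \<in> I" "i \<noteq> j"
    then have "\<phi> i \<noteq> \<phi> j" using net(3) by (auto dest: inj_onD)
    then have "t \<le> dual_norm X (\<phi> i - \<phi> j)" using ij net(4) by (intro t_sep) auto
    then show "\<epsilon> \<le> dual_norm X (\<phi> i - \<phi> j)" using \<epsilon>(3) by simp
  qed
  then have "dual_norm X p \<le> 1 - \<epsilon> / 2"
    using \<epsilon>(1,2) net(1,2) mem R(2) K(2) lim
    by (intro separated_nets_condition_any_index[OF cond 0, unfolded separated_nets_condition_def,
          rule_format, of \<epsilon> I le \<phi> p] conjI) auto
  then show False using K(3)[OF R(2)] \<epsilon> by simp
qed

section \<open>Biorthogonal systems\<close>

lemma dual_space_sum:
  assumes X: "csubspace X" and f: "f \<in> dual_space X" and v: "\<And>i. i \<in> I \<Longrightarrow> v i \<in> X"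
  shows "f (\<Sum>i\<in>I. v i) = (\<Sum>i\<in>I. f (v i))"
proof -
  have f0: "f 0 = 0" using dual_spaceD(2)[OF f complex_vector.subspace_0[OF X], of 0] by simp
  show ?thesis
    using v
  proof (induction I rule: infinite_finite_induct)
    case (insert i I)
    then have "sum v I \<in> X" by (intro complex_vector.subspace_sum[OF X]) auto
    with insert show ?case by (simp add: dual_spaceD(1)[OF f])
  qed (simp_all add: f0)
qed

lemma dual_space_diff_apply:
  assumes X: "csubspace X" and f: "f \<in> dual_space X" and "x \<in> X" "y \<in> X"
  shows "f (x - y) = f x - f y"
  using dual_spaceD(1)[OF f complex_vector.subspace_diff[OF X assms(3,4)] assms(4)] by simp

text \<open>
Choose a total subset \<open>M\<close> of least cardinality. Removing \<open>f\<close> from \<open>M\<close> destroys totality, so there is a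
vector killed by the other members of \<open>M\<close> but not by \<open>f\<close>; normalised, it is \<open>e f\<close>. The difference of
\<open>x\<close> and its expansion is killed by all of \<open>M\<close>.
\<close>

lemma biorthogonal_basis:
  assumes X: "csubspace X" and N: "finite N" "N \<subseteq> dual_space X"
    and total: "\<And>x. x \<in> X \<Longrightarrow> (\<And>f. f \<in> N \<Longrightarrow> f x = 0) \<Longrightarrow> x = 0"
  obtains M e where "M \<subseteq> N" "e ` M \<subseteq> X"
    "\<forall>f\<in>M. \<forall>g\<in>M. f (e g) = (if f = g then 1 else 0)"
    "\<forall>x\<in>X. x = (\<Sum>f\<in>M. f x *\<^sub>C e f)"
proof -
  define tot where "tot M \<longleftrightarrow> (\<forall>x\<in>X. (\<forall>f\<in>M. f x = 0) \<longrightarrow> x = 0)" for M :: "('a \<Rightarrow> complex) set"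
  have "N \<subseteq> N \<and> tot N" using total by (auto simp: tot_def)
  from ex_has_least_nat[of "\<lambda>M. M \<subseteq> N \<and> tot M", OF this, of card]
  obtain M where least: "(M \<subseteq> N \<and> tot M) \<and> (\<forall>L. L \<subseteq> N \<and> tot L \<longrightarrow> card M \<le> card L)"
    by (elim exE)
  then have M: "M \<subseteq> N" "tot M" by simp_all
  have min: "card M \<le> card L" if "L \<subseteq> N" "tot L" for L using least that by simp
  have finM: "finite M" using M(1) N(1) finite_subset by blast
  have dual: "f \<in> dual_space X" if "f \<in> M" for f using that M N by blast
  have "\<exists>y. y \<in> X \<and> f y = 1 \<and> (\<forall>g\<in>M - {f}. g y = 0)" if f: "f \<in> M" for f
  proof -
    have "\<not> tot (M - {f})"
      using min[of "M - {f}"] M(1) card_Diff1_less[OF finM f] by auto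
    then obtain x where x: "x \<in> X" "\<And>g. g \<in> M - {f} \<Longrightarrow> g x = 0" "x \<noteq> 0"
      by (auto simp: tot_def)
    then have "f x \<noteq> 0" using M(2) by (auto simp: tot_def)
    then show ?thesis
      using x f complex_vector.subspace_scale[OF X x(1)]
      by (intro exI[of _ "inverse (f x) *\<^sub>C x"]) (auto simp: dual_spaceD(2)[OF dual x(1)])
  qed
  then have "\<forall>f\<in>M. \<exists>y. y \<in> X \<and> f y = 1 \<and> (\<forall>g\<in>M - {f}. g y = 0)" by simp
  from bchoice[OF this]
  obtain e where e: "\<And>f. f \<in> M \<Longrightarrow> e f \<in> X \<and> f (e f) = 1 \<and> (\<forall>g\<in>M - {f}. g (e f) = 0)"
    by blast
  have expand: "x = (\<Sum>f\<in>M. f x *\<^sub>C e f)" if x: "x \<in> X" for x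
  proof -
    let ?y = "\<Sum>f\<in>M. f x *\<^sub>C e f"
    have v: "f x *\<^sub>C e f \<in> X" if "f \<in> M" for f
      using e[OF that] complex_vector.subspace_scale[OF X] by blast
    have y: "?y \<in> X" using v by (intro complex_vector.subspace_sum[OF X]) 
    have "g (x - ?y) = 0" if g: "g \<in> M" for g
    proof -
      have "g ?y = (\<Sum>f\<in>M. g (f x *\<^sub>C e f))" using v by (intro dual_space_sum[OF X dual[OF g]])
      also have "\<dots> = (\<Sum>f\<in>M. if f = g then g x else 0)"
        using e g by (intro sum.cong refl) (auto simp: dual_spaceD(2)[OF dual[OF g]])
      finally show ?thesis using g finM by (simp add: dual_space_diff_apply[OF X dual[OF g] x y])
    qed
    then have "x - ?y = 0"
      using M(2) complex_vector.subspace_diff[OF X x y] unfolding tot_def by blast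
    then show ?thesis by simp
  qed
  show ?thesis
  proof (rule that[of M e])
    show "\<forall>f\<in>M. \<forall>g\<in>M. f (e g) = (if f = g then 1 else 0)" using e by fastforce
  qed (use M e expand in auto)
qed

section \<open>Uniform algebras\<close>

text \<open>
If no finite set is an \<open>r\<close>-net, a greedy choice produces an infinite \<open>r\<close>-separated sequence.
\<close>

lemma finite_net_if_separated_sets_finite:
  fixes d :: "'b \<Rightarrow> 'b \<Rightarrow> real"
  assumes fin: "\<And>S. S \<subseteq> K \<Longrightarrow> (\<And>u v. u \<in> S \<Longrightarrow> v \<in> S \<Longrightarrow> u \<noteq> v \<Longrightarrow> r \<le> d u v) \<Longrightarrow> finite S"
    and d_sym: "\<And>u v. u \<in> K \<Longrightarrow> v \<in> K \<Longrightarrow> d u v = d v u"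
    and d_self: "\<And>u. u \<in> K \<Longrightarrow> d u u < r"
  obtains N where "finite N" "N \<subseteq> K" "\<And>u. u \<in> K \<Longrightarrow> \<exists>v\<in>N. d u v < r"
proof (rule ccontr)
  assume "\<not> thesis"
  with that have no_net: "\<exists>u\<in>K. \<forall>v\<in>N. r \<le> d u v" if "finite N" "N \<subseteq> K" for N
    using that by (meson not_le)
  have "\<exists>s. \<forall>n::nat. s n \<in> K \<and> (\<forall>m<n. r \<le> d (s n) (s m))"
  proof (rule dependent_wellorder_choice)
    fix n :: nat and s
    assume s: "\<And>m. m < n \<Longrightarrow> s m \<in> K \<and> (\<forall>k<m. r \<le> d (s m) (s k))"
    then have "s ` {..<n} \<subseteq> K" by auto
    then show "\<exists>u. u \<in> K \<and> (\<forall>m<n. r \<le> d u (s m))" using no_net[of "s ` {..<n}"] by auto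
  qed auto
  then obtain s where s: "\<And>n. s n \<in> K" "\<And>m n::nat. m < n \<Longrightarrow> r \<le> d (s n) (s m)" by blast
  have sep: "r \<le> d (s m) (s n)" if "m \<noteq> n" for m n
    using that s(2)[of m n] s(2)[of n m] d_sym[OF s(1) s(1), of m n] by (cases "m < n") auto
  have "finite (range s)"
    by (rule fin) (use s(1) in \<open>auto intro: sep\<close>)
  moreover have "inj s"
  proof (rule injI, rule ccontr)
    fix m n assume "s m = s n" "m \<noteq> n"
    then show False using sep[of m n] d_self[OF s(1), of n] by simp
  qed
  ultimately show False using finite_imageD[of s UNIV] by simp
qed

text \<open>
The point evaluations form a weak* compact subset of the dual sphere, and all of them attain their
norm at the constant function \<open>1\<close>. Hence finitely many evaluations are \<open>1/2\<close>-dense among them in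
norm. A function vanishing at these finitely many points satisfies \<open>norm f \<le> norm f / 2\<close>, so it is
zero.
\<close>

theorem uniform_algebra_finite_dimensional:
  fixes A :: "('w :: t2_space \<Rightarrow>\<^sub>C complex) set"
  assumes A: "uniform_algebra A" and dagger: "property_ddagger A"
  shows "finite_dimensional A"
proof -
  have X: "csubspace A" and comp: "compact (UNIV :: 'w set)" and const: "const_bcontfun c \<in> A" for c
    using A by (auto simp: uniform_algebra_def)
  have 0: "0 \<in> A" using X by (rule complex_vector.subspace_0)
  define ev where "ev w f = (if f \<in> A then apply_bcontfun f w else 0)" for w :: 'w and f
  have ev_dual: "ev w \<in> dual_space A" for w
  proof (rule dual_spaceI[where K = 1])
    show "cmod (ev w f) \<le> 1 * norm f" if "f \<in> A" for f
      using norm_bounded[of f w] that by (simp add: ev_def)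
  qed (use X in \<open>auto simp: ev_def scaleC_complex_def complex_vector.subspace_add complex_vector.subspace_scale\<close>)
  have one: "const_bcontfun 1 \<in> A \<inter> cball 0 1"
    using const[of 1] by (auto simp: dist_norm intro!: norm_bound)
  have ev_norm: "dual_norm A (ev w) = 1" for w
  proof (rule antisym)
    show "dual_norm A (ev w) \<le> 1"
    proof (rule dual_norm_least[OF 0])
      show "cmod (ev w f) \<le> 1" if "f \<in> A" "norm f \<le> 1" for f
        using norm_bounded[of f w] that by (simp add: ev_def)
    qed
    show "1 \<le> dual_norm A (ev w)"
      using dual_norm_upper[OF ev_dual, of "const_bcontfun 1" w] one by (simp add: ev_def dist_norm)
  qed
  have ev_attain: "norm_attaining A (ev w)" for w
    unfolding norm_attaining_def
    using one by (intro bexI[of _ "const_bcontfun 1"]) (auto simp: ev_norm ev_def)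
  have "compact (range ev)"
  proof (rule compact_continuous_image[OF _ comp])
    show "continuous_on UNIV ev"
    proof (rule continuous_on_coordinatewise_then_product)
      show "continuous_on UNIV (\<lambda>w. ev w f)" for f by (cases "f \<in> A") (simp_all add: ev_def)
    qed
  qed
  moreover have "range ev \<subseteq> dual_ball A \<inter> {f \<in> dual_space A. norm_attaining A f}"
    using ev_dual ev_norm ev_attain by (auto simp: dual_ball_def)
  ultimately have fin: "finite S"
    if "S \<subseteq> range ev" "\<And>f g. f \<in> S \<Longrightarrow> g \<in> S \<Longrightarrow> f \<noteq> g \<Longrightarrow> 1 / 2 \<le> dual_norm A (f - g)" for S
    using that dagger ev_norm unfolding property_ddagger_def
    by (intro finite_separated_subset_of_sphere[OF X, of _ "range ev" S "1 / 2"]) auto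
  obtain N where N: "finite N" "N \<subseteq> range ev" "\<And>f. f \<in> range ev \<Longrightarrow> \<exists>g\<in>N. dual_norm A (f - g) < 1 / 2"
  proof (rule finite_net_if_separated_sets_finite[of "range ev" "1 / 2" "\<lambda>f g. dual_norm A (f - g)"])
    show "finite S" if "S \<subseteq> range ev" "\<And>f g. f \<in> S \<Longrightarrow> g \<in> S \<Longrightarrow> f \<noteq> g \<Longrightarrow> 1 / 2 \<le> dual_norm A (f - g)" for S
      using that by (rule fin)
    show "dual_norm A (f - g) = dual_norm A (g - f)" if "f \<in> range ev" "g \<in> range ev" for f g
      using that ev_dual 0 by (intro dual_norm_minus_commute) auto
    show "dual_norm A (f - f) < 1 / 2" for f using 0 by (simp add: dual_norm_zero)
  qed blast
  have total: "f = 0" if f: "f \<in> A" "\<And>g. g \<in> N \<Longrightarrow> g f = 0" for f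
  proof -
    have "norm (apply_bcontfun f w) \<le> 1 / 2 * norm f" for w
    proof -
      obtain g where g: "g \<in> N" "dual_norm A (ev w - g) < 1 / 2" using N(3)[of "ev w"] by blast
      have "g \<in> dual_space A" using g(1) N(2) ev_dual by blast
      then have "cmod ((ev w - g) f) \<le> dual_norm A (ev w - g) * norm f"
        by (intro dual_norm_bound[OF X dual_space_diff[OF ev_dual] f(1)])
      also have "\<dots> \<le> 1 / 2 * norm f" using g(2) by (intro mult_right_mono) auto
      finally show ?thesis using f(1) f(2)[OF g(1)] by (simp add: ev_def)
    qed
    then have "norm f \<le> 1 / 2 * norm f" by (rule norm_bound)
    then show ?thesis by simp
  qed
  have N_dual: "N \<subseteq> dual_space A" using N(2) ev_dual by blast
  obtain M e where M: "M \<subseteq> N" "e ` M \<subseteq> A" "\<forall>x\<in>A. x = (\<Sum>f\<in>M. f x *\<^sub>C e f)"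
    by (rule biorthogonal_basis[OF X N(1) N_dual total])
  have "A = cspan (e ` M)"
  proof
    show "A \<subseteq> cspan (e ` M)"
    proof
      fix x assume "x \<in> A"
      have "(\<Sum>f\<in>M. f x *\<^sub>C e f) \<in> cspan (e ` M)"
        by (intro complex_vector.span_sum complex_vector.span_scale complex_vector.span_base imageI)
      then show "x \<in> cspan (e ` M)" using bspec[OF M(3) \<open>x \<in> A\<close>] by simp
    qed
    show "cspan (e ` M) \<subseteq> A" using M(2) X by (rule complex_vector.span_minimal)
  qed
  moreover have "finite (e ` M)" using M(1) N(1) finite_subset by blast
  ultimately show ?thesis using M(2) unfolding finite_dimensional_def by blast
qed

text \<open>
The isometry is \<open>x \<mapsto> (f x)\<close> with \<open>f\<close> in \<open>S\<close>; the biorthogonal vectors \<open>e f\<close> are preimages of the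
unit vectors, which makes it surjective.
\<close>

section \<open>Spaces with many L-summands\<close>

lemma isometric_linfty:
  assumes X: "csubspace X" and S: "finite S" "S \<noteq> {}" "S \<subseteq> dual_space X"
    and e: "\<And>f. f \<in> S \<Longrightarrow> e f \<in> X" "\<And>f g. f \<in> S \<Longrightarrow> g \<in> S \<Longrightarrow> f (e g) = (if f = g then 1 else 0)"
    and norm: "\<And>x. x \<in> X \<Longrightarrow> norm x = Max ((\<lambda>f. cmod (f x)) ` S)"
  shows "isometric_spaces X (linfty (card S))"
proof -
  define k where "k = card S"
  have k: "k > 0" using S by (simp add: k_def card_gt_0_iff)
  obtain \<sigma> where \<sigma>: "bij_betw \<sigma> {..<k} S"
    using ex_bij_betw_nat_finite[OF S(1)] by (auto simp: k_def atLeast0LessThan)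
  have \<sigma>_S: "\<sigma> i \<in> S" if "i < k" for i using \<sigma> that by (auto simp: bij_betw_def)
  have \<sigma>_dual: "\<sigma> i \<in> dual_space X" if "i < k" for i using \<sigma>_S[OF that] S(3) by blast
  define T where "T x = Bcontfun (\<lambda>i. if i < k then \<sigma> i x else 0)" for x
  have T: "apply_bcontfun (T x) i = (if i < k then \<sigma> i x else 0)" for x i
  proof -
    have "(\<lambda>i. if i < k then \<sigma> i x else 0) \<in> bcontfun"
    proof (rule bcontfun_normI)
      show "cmod (if i < k then \<sigma> i x else 0) \<le> (\<Sum>i<k. cmod (\<sigma> i x))" for i
        by (auto intro: member_le_sum sum_nonneg)
    qed simp
    then show ?thesis by (simp add: T_def Bcontfun_inverse)
  qed
  have T_mem: "T x \<in> linfty k" for x by (simp add: linfty_def T)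
  have T_norm: "norm (T x) = norm x" if "x \<in> X" for x
  proof -
    have "(\<lambda>i. cmod (apply_bcontfun (T x) i)) ` {..<k} = (\<lambda>f. cmod (f x)) ` (\<sigma> ` {..<k})"
      by (auto simp: T image_image)
    then show ?thesis
      using norm_linfty[OF T_mem k, of x] norm[OF that] \<sigma> by (simp add: bij_betw_def)
  qed
  have T_add: "T (x + y) = T x + T y" if "x \<in> X" "y \<in> X" for x y
    using that by (intro bcontfun_eqI) (auto simp: T dual_spaceD(1)[OF \<sigma>_dual])
  have T_scale: "T (c *\<^sub>C x) = c *\<^sub>C T x" if "x \<in> X" for c x
    using that by (intro bcontfun_eqI) (auto simp: T scaleC_complex_def dual_spaceD(2)[OF \<sigma>_dual])
  have "inj_on T X"
  proof (rule inj_onI)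
    fix x y assume xy: "x \<in> X" "y \<in> X" "T x = T y"
    have d: "x - y \<in> X" using X xy(1,2) by (rule complex_vector.subspace_diff)
    have "T x = T (x - y) + T y" using T_add[OF d xy(2)] by simp
    then have "norm (x - y) = 0" using T_norm[OF d] xy(3) by simp
    then show "x = y" by simp
  qed
  moreover have "T ` X = linfty k"
  proof
    show "linfty k \<subseteq> T ` X"
    proof
      fix v assume v: "v \<in> linfty k"
      define x where "x = (\<Sum>i<k. apply_bcontfun v i *\<^sub>C e (\<sigma> i))"
      have summand: "apply_bcontfun v i *\<^sub>C e (\<sigma> i) \<in> X" if "i < k" for i
        using e(1)[OF \<sigma>_S[OF that]] X by (intro complex_vector.subspace_scale)
      have x: "x \<in> X" unfolding x_def using summand by (intro complex_vector.subspace_sum[OF X]) auto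
      have "T x = v"
      proof (rule bcontfun_eqI)
        fix j show "apply_bcontfun (T x) j = apply_bcontfun v j"
        proof (cases "j < k")
          case True
          have "\<sigma> j x = (\<Sum>i<k. \<sigma> j (apply_bcontfun v i *\<^sub>C e (\<sigma> i)))"
            unfolding x_def using summand by (intro dual_space_sum[OF X \<sigma>_dual[OF True]]) auto
          also have "\<dots> = (\<Sum>i<k. if i = j then apply_bcontfun v j else 0)"
          proof (intro sum.cong refl)
            fix i assume "i \<in> {..<k}"
            then have i: "i < k" by simp
            have "\<sigma> j = \<sigma> i \<longleftrightarrow> i = j" using \<sigma> i True by (auto simp: bij_betw_def inj_on_def)
            then show "\<sigma> j (apply_bcontfun v i *\<^sub>C e (\<sigma> i)) = (if i = j then apply_bcontfun v j else 0)"
              using dual_spaceD(2)[OF \<sigma>_dual[OF True] e(1)[OF \<sigma>_S[OF i]]] e(2)[OF \<sigma>_S[OF True] \<sigma>_S[OF i]]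
              by auto
          qed
          finally show ?thesis using True by (simp add: T)
        next
          case False
          then show ?thesis using v by (simp add: T linfty_def)
        qed
      qed
      then show "v \<in> T ` X" using x by blast
    qed
  qed (use T_mem in auto)
  ultimately have "bij_betw T X (linfty k)" by (simp add: bij_betw_def)
  then show ?thesis
    using T_add T_scale T_norm unfolding isometric_spaces_def k_def by blast
qed

text \<open>
If both parts were nonzero, additivity of the norm would exhibit \<open>g\<close> as a proper convex combination
of the normalised parts.
\<close>

lemma extreme_point_in_L_decomposition:
  assumes X: "csubspace X"
    and M: "csubspace M" "M \<subseteq> dual_space X" and N: "csubspace N" "N \<subseteq> dual_space X"
    and MN: "M \<inter> N = {0}"
    and L: "\<And>m n. m \<in> M \<Longrightarrow> n \<in> N \<Longrightarrow> dual_norm X (m + n) = dual_norm X m + dual_norm X n"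
    and g: "g \<in> dual_extreme_points X" "dual_norm X g = 1" "g = m + n" "m \<in> M" "n \<in> N"
  shows "m = 0 \<or> n = 0"
proof (rule ccontr)
  assume "\<not> (m = 0 \<or> n = 0)"
  then have ne: "m \<noteq> 0" "n \<noteq> 0" by auto
  have 0: "0 \<in> X" using X by (rule complex_vector.subspace_0)
  have md: "m \<in> dual_space X" and nd: "n \<in> dual_space X" using g M N by auto
  define a b where "a = dual_norm X m" and "b = dual_norm X n"
  have ab: "a > 0" "b > 0" "a = 1 - b"
    using dual_norm_eq_0[OF X md] dual_norm_eq_0[OF X nd] ne L[OF g(4,5)] g(2,3)
    by (auto simp: a_def b_def not_le)
  define m' n' where "m' = complex_of_real (inverse a) *\<^sub>C m" and "n' = complex_of_real (inverse b) *\<^sub>C n"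
  have mem: "m' \<in> M" "n' \<in> N"
    using g M N by (auto simp: m'_def n'_def complex_vector.subspace_scale)
  have mm: "m = a *\<^sub>R m'" and nn: "n = b *\<^sub>R n'"
    using ab by (simp_all add: m'_def n'_def scaleR_scaleC scaleC_scaleC flip: of_real_mult)
  have "m' \<in> dual_ball X" "n' \<in> dual_ball X"
    using ab(1,2) by (auto simp: dual_ball_def m'_def n'_def dual_space_scaleC md nd dual_norm_scaleC 0
        norm_inverse a_def[symmetric] b_def[symmetric])
  moreover have "m' \<noteq> n'" using mem MN mm ne(1) by auto
  moreover have "g = (1 - b) *\<^sub>R m' + b *\<^sub>R n'" using g(3) mm nn ab(3) by simp
  ultimately show False
    using g(1) ab unfolding dual_extreme_points_def extreme_point_of_def
    by (auto simp: in_segment)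
qed

lemma cspan_singleton_scaleC: "c \<noteq> 0 \<Longrightarrow> cspan {c *\<^sub>C f} = cspan {f}"
  for f :: "'a :: complex_vector"
  using complex_vector.span_singleton[of "c *\<^sub>C f"] complex_vector.span_singleton[of f]
  by (auto simp: scaleC_scaleC image_iff intro!: exI[of _ "_ / c"])

text \<open>
An extreme point lies in one of the two summands, so one that spans another line lies in the
complement of the line of \<open>f\<close>, where additivity of the norm puts it at distance \<open>1 + 1\<close> from \<open>f\<close>.
\<close>

lemma L_summand_complement:
  assumes X: "csubspace X" and L: "L_summand X (cspan {f})" and f: "dual_norm X f = 1"
  obtains N where "csubspace N" "f \<notin> N"
    "\<forall>g\<in>dual_extreme_points X. dual_norm X g = 1 \<longrightarrow> cspan {g} \<noteq> cspan {f} \<longrightarrow>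
      g \<in> N \<and> dual_norm X (f - g) = 2"
proof -
  have 0: "0 \<in> X" using X by (rule complex_vector.subspace_0)
  have f0: "f \<noteq> 0" using f dual_norm_zero[OF 0] by auto
  have fM: "f \<in> cspan {f}" by (simp add: complex_vector.span_base)
  have M: "cspan {f} \<subseteq> dual_space X"
    using L unfolding L_summand_def norm_closed_subspace_def by simp
  obtain N where "norm_closed_subspace X N" and int: "cspan {f} \<inter> N = {0}"
    and decomp: "\<forall>g\<in>dual_space X. \<exists>m\<in>cspan {f}. \<exists>n\<in>N. g = m + n"
    and norm: "\<forall>m\<in>cspan {f}. \<forall>n\<in>N. dual_norm X (m + n) = dual_norm X m + dual_norm X n"
    using L unfolding L_summand_def by (elim conjE exE)
  then have N: "csubspace N" "N \<subseteq> dual_space X" by (simp_all add: norm_closed_subspace_def)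
  show ?thesis
  proof (rule that[OF N(1)])
    show "f \<notin> N" using int fM f0 by blast
    show "\<forall>g\<in>dual_extreme_points X. dual_norm X g = 1 \<longrightarrow> cspan {g} \<noteq> cspan {f} \<longrightarrow>
      g \<in> N \<and> dual_norm X (f - g) = 2"
    proof (intro ballI impI)
      fix g assume g: "g \<in> dual_extreme_points X" "dual_norm X g = 1" "cspan {g} \<noteq> cspan {f}"
      have gd: "g \<in> dual_space X"
        using g(1) by (auto simp: dual_extreme_points_def extreme_point_of_def dual_ball_def)
      from bspec[OF decomp this] obtain m n where mn: "m \<in> cspan {f}" "n \<in> N" "g = m + n" by blast
      have "m = 0 \<or> n = 0"
        using extreme_point_in_L_decomposition[OF X complex_vector.subspace_span M N int norm[rule_format] g(1,2) mn(3,1,2)] .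
      moreover have "n \<noteq> 0"
      proof
        assume "n = 0"
        then obtain c where "g = c *\<^sub>C f" using mn(1,3) by (auto simp: complex_vector.span_singleton)
        moreover have "c \<noteq> 0" using g(2) dual_norm_zero[OF 0] calculation by auto
        ultimately show False using g(3) cspan_singleton_scaleC by blast
      qed
      ultimately have gN: "g \<in> N" using mn by simp
      have "dual_norm X (f + - g) = dual_norm X f + dual_norm X (- g)"
        using norm[rule_format, OF fM complex_vector.subspace_neg[OF N(1) gN]] .
      moreover have "dual_norm X (- g) = 1"
        using dual_norm_scaleC[OF gd 0, of "- 1"] g(2) by (simp add: uminus_eq_scaleC[symmetric])
      ultimately show "g \<in> N \<and> dual_norm X (f - g) = 2" using gN f by simp
    qed
  qed
qed

text \<open>
Let \<open>D\<close> be the set of extreme points whose span is an L-summand. One representative on each line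
spanned by a member of \<open>D\<close> gives a set \<open>S\<close> of norm-one functionals with
mutual distance \<open>2\<close>, so \<open>S\<close> is finite. Being dense in the extreme points up to unimodular factors,
\<open>S\<close> norms \<open>X\<close>, so \<open>x \<mapsto> (f x)\<close>, with \<open>f\<close> in \<open>S\<close>, is isometric into \<open>\<ell>\<^sup>\<infinity>\<close>. It is onto because no
member of \<open>S\<close> lies in the span of the others, which is contained in its complementary L-summand.
\<close>

theorem isometric_linfty_of_dense_L_summands:
  fixes X :: "'a :: complex_normed_vector set"
  assumes X: "csubspace X"
    and dense: "dual_extreme_points X \<subseteq>
      weak_star X closure_of {f \<in> dual_extreme_points X. L_summand X (cspan {f})}"
    and sphere: "weak_star X closure_of dual_extreme_points X \<subseteq> dual_sphere X"
    and dagger: "property_dagger X"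
  shows "\<exists>k>0. isometric_spaces X (linfty k)"
proof -
  define E where "E = dual_extreme_points X"
  define D where "D = {f \<in> E. L_summand X (cspan {f})}"
  have 0: "0 \<in> X" using X by (rule complex_vector.subspace_0)
  have E_ball: "E \<subseteq> dual_ball X" and E_dual: "E \<subseteq> dual_space X"
    by (auto simp: E_def dual_extreme_points_def extreme_point_of_def dual_ball_def)
  have clos: "weak_star X closure_of S = dual_space X \<inter> closure S" if "S \<subseteq> dual_space X" for S
    using that by (simp add: weak_star_def closure_of_subtopology Int_absorb1)
  have closE_ball: "closure E \<subseteq> dual_ball X"
    using E_ball compact_dual_ball[OF X] by (intro closure_minimal compact_imp_closed)
  have closE_dual: "closure E \<subseteq> dual_space X" using closE_ball by (auto simp: dual_ball_def)
  have norm_1: "dual_norm X f = 1" if "f \<in> closure E" for f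
    using sphere that closE_dual E_dual clos[of E] by (auto simp: E_def dual_sphere_def)
  have E_closD: "E \<subseteq> closure D"
    using dense clos[of D] E_dual by (auto simp: E_def D_def)
  have compE: "compact (closure E)"
    using compact_Int_closed[OF compact_dual_ball[OF X] closed_closure, of E] closE_ball
    by (simp add: Int_absorb1)
  have DE: "D \<subseteq> E" "E \<subseteq> closure E" by (auto simp: D_def closure_subset)
  \<comment> \<open>The representative depends only on the line spanned by \<open>f\<close>.\<close>
  define rep where "rep f = (SOME g. g \<in> D \<and> cspan {g} = cspan {f})" for f
  define S where "S = rep ` D"
  have rep: "rep f \<in> D \<and> cspan {rep f} = cspan {f}" if "f \<in> D" for f
    unfolding rep_def by (rule someI[of "\<lambda>g. g \<in> D \<and> cspan {g} = cspan {f}" f]) (simp add: that)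
  have SD: "S \<subseteq> D" using rep by (auto simp: S_def)
  have S_lines: "cspan {f} \<noteq> cspan {g}" if fg: "f \<in> S" "g \<in> S" "f \<noteq> g" for f g
  proof
    assume eq: "cspan {f} = cspan {g}"
    obtain f' g' where "f' \<in> D" "g' \<in> D" "f = rep f'" "g = rep g'"
      using fg unfolding S_def by blast
    moreover have "cspan {f'} = cspan {g'}"
      using eq rep[OF \<open>f' \<in> D\<close>] rep[OF \<open>g' \<in> D\<close>] calculation(3,4) by simp
    ultimately show False using fg(3) by (simp add: rep_def)
  qed
  have S_norm: "dual_norm X f = 1" if "f \<in> S" for f using that SD DE norm_1 by blast
  have S_ext: "f \<in> dual_extreme_points X" if "f \<in> S" for f using that SD DE by (auto simp: E_def)
  have compl: "\<exists>N. csubspace N \<and> f \<notin> N \<and> (\<forall>g\<in>S - {f}. g \<in> N \<and> dual_norm X (f - g) = 2)"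
    if f: "f \<in> S" for f
  proof -
    have L: "L_summand X (cspan {f})" using f SD by (auto simp: D_def)
    obtain N where N: "csubspace N" "f \<notin> N"
      "\<forall>g\<in>dual_extreme_points X. dual_norm X g = 1 \<longrightarrow> cspan {g} \<noteq> cspan {f} \<longrightarrow>
        g \<in> N \<and> dual_norm X (f - g) = 2"
      by (rule L_summand_complement[OF X L S_norm[OF f]])
    have "\<forall>g\<in>S - {f}. g \<in> N \<and> dual_norm X (f - g) = 2"
      using N(3) S_ext S_norm S_lines f by auto
    with N(1,2) show ?thesis by blast
  qed
  have finS: "finite S"
  proof (rule finite_separated_subset_of_sphere[OF X _ compE, of "dual_space X" S 2])
    show "separated_nets_condition TYPE('a \<Rightarrow> complex) X (dual_space X)"
      using dagger by (simp add: property_dagger_def)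
    show "2 \<le> dual_norm X (f - g)" if "f \<in> S" "g \<in> S" "f \<noteq> g" for f g
      using compl[OF that(1)] that by auto
  qed (use closE_ball closE_dual SD DE norm_1 in auto)
  have S_ne: "S \<noteq> {}"
  proof -
    obtain f where "f \<in> E"
      unfolding E_def by (rule norming_extreme_point[OF X 0])
    then have "f \<in> closure D" by (rule subsetD[OF E_closD])
    then have "D \<noteq> {}" by auto
    then show ?thesis by (simp add: S_def)
  qed
  have S_dual: "S \<subseteq> dual_space X" using SD DE E_dual by blast
  have norm_eq: "norm x = Max ((\<lambda>f. cmod (f x)) ` S)" if x: "x \<in> X" for x
  proof (rule antisym)
    \<comment> \<open>The bound holds on \<open>D\<close>, because a member of \<open>D\<close> is a unimodular multiple of its representative;
      it passes to the weak* closure and so to an extreme point that norms \<open>x\<close>.\<close>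
    let ?m = "Max ((\<lambda>f. cmod (f x)) ` S)"
    have "D \<subseteq> {f. cmod (f x) \<le> ?m}"
    proof
      fix f assume f: "f \<in> D"
      have "f \<in> cspan {rep f}" using rep[OF f] complex_vector.span_base[of f "{f}"] by simp
      then obtain c where c: "f = c *\<^sub>C rep f" by (auto simp: complex_vector.span_singleton)
      have repS: "rep f \<in> S" using f by (simp add: S_def)
      have "cmod c * dual_norm X (rep f) = dual_norm X f"
        using dual_norm_scaleC[of "rep f" X c] repS S_dual 0 c by auto
      then have "cmod c = 1" using S_norm[OF repS] norm_1 f DE by auto
      then have "cmod (f x) = cmod (rep f x)"
        using arg_cong[OF c, of "\<lambda>f. cmod (f x)"] by (simp add: scaleC_fun_def scaleC_complex_def norm_mult)
      also have "\<dots> \<le> ?m" using repS finS by (intro Max_ge) auto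
      finally show "f \<in> {f. cmod (f x) \<le> ?m}" by simp
    qed
    moreover have "closed {f :: 'a \<Rightarrow> complex. cmod (f x) \<le> ?m}"
      by (intro closed_Collect_le continuous_on_norm continuous_on_product_coordinates continuous_on_const)
    ultimately have "E \<subseteq> {f. cmod (f x) \<le> ?m}" using E_closD closure_minimal by blast
    moreover obtain f where "f \<in> E" "cmod (f x) = norm x"
      using norming_extreme_point[OF X x] unfolding E_def by blast
    ultimately show "norm x \<le> ?m" by auto
    have "cmod (f x) \<le> norm x" if "f \<in> S" for f
      using that SD DE E_ball by (intro dual_ball_bound[OF X _ x]) blast
    then show "?m \<le> norm x" using finS S_ne by (subst Max_le_iff) auto
  qed
  have total: "x = 0" if "x \<in> X" "\<And>f. f \<in> S \<Longrightarrow> f x = 0" for x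
  proof -
    have "norm x \<le> 0"
      unfolding norm_eq[OF that(1)] using finS S_ne that(2) by (subst Max_le_iff) auto
    then show ?thesis by simp
  qed
  obtain M e where M: "M \<subseteq> S" and e_mem: "e ` M \<subseteq> X"
    and e_apply: "\<forall>f\<in>M. \<forall>g\<in>M. f (e g) = (if f = g then 1 else 0)"
    and expand: "\<forall>x\<in>X. x = (\<Sum>f\<in>M. f x *\<^sub>C e f)"
    by (rule biorthogonal_basis[OF X finS S_dual total])
  have e: "e f \<in> X" if "f \<in> M" for f using e_mem that by blast
  \<comment> \<open>A functional omitted from the basis would be a combination of the others.\<close>
  have "S \<subseteq> M"
  proof
    fix f assume f: "f \<in> S"
    show "f \<in> M"
    proof (rule ccontr)
      assume fM: "f \<notin> M"
      obtain N where N: "csubspace N" "f \<notin> N" "\<forall>g\<in>S - {f}. g \<in> N \<and> dual_norm X (f - g) = 2"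
        using compl[OF f] by blast
      have fd: "f \<in> dual_space X" using f S_dual by blast
      have "f = (\<Sum>g\<in>M. f (e g) *\<^sub>C g)"
      proof
        fix x
        have app: "(\<Sum>g\<in>M. f (e g) *\<^sub>C g) x = (\<Sum>g\<in>M. f (e g) * g x)"
          by (induction M rule: infinite_finite_induct) (auto simp: scaleC_fun_def scaleC_complex_def)
        show "f x = (\<Sum>g\<in>M. f (e g) *\<^sub>C g) x"
        proof (cases "x \<in> X")
          case True
          have "f x = f (\<Sum>g\<in>M. g x *\<^sub>C e g)" using bspec[OF expand True] by simp
          also have "\<dots> = (\<Sum>g\<in>M. f (g x *\<^sub>C e g))"
            using e X by (intro dual_space_sum[OF X fd] complex_vector.subspace_scale)
          also have "\<dots> = (\<Sum>g\<in>M. f (e g) * g x)"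
            using e by (intro sum.cong) (auto simp: dual_spaceD(2)[OF fd])
          finally show ?thesis by (simp add: app)
        next
          case False
          then have "g x = 0" if "g \<in> M" for g using that M S_dual dual_spaceD(3) by blast
          then have "(\<Sum>g\<in>M. f (e g) * g x) = 0" by (intro sum.neutral) simp
          then show ?thesis using False dual_spaceD(3)[OF fd] by (simp add: app)
        qed
      qed
      also have "\<dots> \<in> N"
        using N(1,3) M fM by (intro complex_vector.subspace_sum complex_vector.subspace_scale) auto
      finally show False using N(2) by blast
    qed
  qed
  then have "M = S" using M by blast
  then have "isometric_spaces X (linfty (card S))"
    using e e_apply finS S_ne S_dual norm_eq by (intro isometric_linfty[OF X]) auto
  moreover have "card S > 0" using finS S_ne by (simp add: card_gt_0_iff)
  ultimately show ?thesis by blast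
qed

theorem theorem21:
  fixes X :: "'a :: complex_normed_vector set"
    and A :: "('w :: t2_space \<Rightarrow>\<^sub>C complex) set"
  shows "(csubspace X \<and> complete X \<and>
           dual_extreme_points X \<subseteq>
             weak_star X closure_of {f \<in> dual_extreme_points X. L_summand X (cspan {f})} \<and>
           weak_star X closure_of dual_extreme_points X \<subseteq> dual_sphere X \<and>
           property_dagger X
           \<longrightarrow> (\<exists>k>0. isometric_spaces X (linfty k)))
       \<and> (uniform_algebra A \<and> property_ddagger A \<longrightarrow> finite_dimensional A)"
  using isometric_linfty_of_dense_L_summands[of X] uniform_algebra_finite_dimensional[of A]
  by blast

end
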